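(* For $d=1,2$ one has $$\widetilde M_d(Th^W)\subset Th^W .$$ That is, for every $f\in Th^W$ the functions $\widetilde M_1f$ and $\widetilde M_2f$ again belong to $Th^W$, where $$\widetilde M_1:=\sum_{p\in\mathcal{P}_1}\ \prod_{q\in\mathcal{P}_1,\ q\neq\pm p}\frac{[\lambda_{p+q}-\hbar]}{[\lambda_{p+q}]}\,T_{\widehat p},$$ $$\widetilde M_2:=\sum_{p=\pm\varepsilon_1,\ q=\pm\varepsilon_2}\left(\frac{[\lambda_{p+q}-\hbar]}{[\lambda_{p+q}+\hbar]}T_{\widehat p}T_{\widehat q}+\frac{[2\hbar]}{[6\hbar]}\frac{[2\lambda_p+2\hbar]}{[2\lambda_p]}\frac{[2\lambda_q+2\hbar]}{[2\lambda_q]}\frac{[\lambda_{p+q}-5\hbar]}{[\lambda_{p+q}+\hbar]}\frac{[\lambda_{p+q}+2\hbar]}{[\lambda_{p+q}]}\right).$$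
   Context: Theta function. Fix $\tau\in\mathbb{C}$ with $\Im\tau>0$, $\mathrm{p}=e^{2\pi i\tau}$, $\mathrm{p}^{1/8}=e^{\pi i\tau/4}$, and $$[u]:=i\,\mathrm{p}^{1/8}\sin(\pi u)\prod_{m\ge1}(1-2\mathrm{p}^m\cos 2\pi u+\mathrm{p}^{2m})(1-\mathrm{p}^m).$$ $\hbar$ is a fixed generic nonzero complex number (so that $[m\hbar]\ne0$ for all nonzero integers $m$). Weights. $\mathfrak{h}^*$ is the two-dimensional complex vector space with basis $\varepsilon_1,\varepsilon_2$ and symmetric bilinear form $(\varepsilon_j,\varepsilon_k)=\frac12\delta_{jk}$ (the dual of a Cartan subalgebra of $\mathfrak{sp}(4,\mathbb{C})$, identified with the Cartan subalgebra via the form). $\mathcal{P}_1=\{\pm\varepsilon_1,\pm\varepsilon_2\}$. For $\lambda,p\in\mathfrak{h}^*$ put $\lambda_p:=(\lambda,p)$, and $(T_{\widehat p}f)(\lambda):=f(\lambda+2\hbar p)$. The operators $\widetilde M_d$ act on meromorphic functions on $\mathfrak{h}^*$; the second summand of $\widetilde M_2$ acts by multiplication. Theta functions. The coroot lattice is $Q^\vee=\mathbb{Z}\,2\varepsilon_1\oplus\mathbb{Z}\,2\varepsilon_2$. $W\subset GL(\mathfrak{h}^* )$ is the Weyl group of type $C_2$ (generated by the permutation of $\varepsilon_1,\varepsilon_2$ and the sign changes $\varepsilon_j\mapsto-\varepsilon_j$). For $\beta\in\mathfrak{h}^*$ define operators on functions on $\mathfrak{h}^*$ by $$(S_{\tau\beta}f)(\lambda):=\exp\left[2\pi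 i\left((\lambda,\beta)+\tau(\beta,\beta)/2\right)\right]f(\lambda+\tau\beta),\qquad (S_\beta f)(\lambda):=f(\lambda+\beta).$$ $Th^W$ is the space of holomorphic functions $f$ on $\mathfrak{h}^*$ such that $S_{\tau\alpha}f=S_\alpha f=f$ for all $\alpha\in Q^\vee$ and $f(w\lambda)=f(\lambda)$ for all $w\in W$. *)

theory Defs
  imports "HOL-Analysis.Analysis"
begin

definition theta :: "complex \<Rightarrow> complex \<Rightarrow> complex" where
  "theta \<tau> u =
     (let p = exp (2 * of_real pi * \<i> * \<tau>) in
      \<i> * exp (of_real pi * \<i> * \<tau> / 4) * sin (of_real pi * u) *
      (\<Prod>m. (1 - 2 * p ^ Suc m * cos (2 * of_real pi * u) + p ^ (2 * Suc m)) * (1 - p ^ Suc m)))"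

type_synonym weight = "complex ^ 2"

definition eps :: "2 \<Rightarrow> weight" where
  "eps j = axis j 1"

text \<open>The symmetric complex bilinear (not Hermitian) form with \<open>form (eps j) (eps k) = \<delta>\<^sub>j\<^sub>k / 2\<close>.\<close>

definition form :: "weight \<Rightarrow> weight \<Rightarrow> complex" where
  "form x y = (\<Sum>j\<in>UNIV. x $ j * y $ j) / 2"

lemma form_eps: "form (eps j) (eps k) = (if j = k then 1 / 2 else 0)"
proof -
  have "(\<Sum>i\<in>UNIV. eps j $ i * eps k $ i) = (\<Sum>i\<in>UNIV. if i = j then (if j = k then 1 else 0) else 0)"
    by (intro sum.cong) (auto simp: eps_def axis_def)
  then show ?thesis
    by (simp add: form_def)
qed

definition P1 :: "weight set" where
  "P1 = {eps 1, - eps 1, eps 2, - eps 2}"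

definition coroot_lattice :: "weight set" where
  "coroot_lattice = {of_int a *s (2 *s eps 1) + of_int b *s (2 *s eps 2) | a b :: int. True}"

definition transpose_eps :: "weight \<Rightarrow> weight" where
  "transpose_eps x = x $ 2 *s eps 1 + x $ 1 *s eps 2"

definition sign_change :: "2 \<Rightarrow> weight \<Rightarrow> weight" where
  "sign_change j x = (\<chi> k. if k = j then - (x $ k) else x $ k)"

inductive_set weyl_C2 :: "(weight \<Rightarrow> weight) set" where
  transpose: "transpose_eps \<in> weyl_C2"
| sign: "sign_change j \<in> weyl_C2"
| id: "id \<in> weyl_C2"
| comp: "v \<in> weyl_C2 \<Longrightarrow> w \<in> weyl_C2 \<Longrightarrow> v \<circ> w \<in> weyl_C2"
| inv: "w \<in> weyl_C2 \<Longrightarrow> inv w \<in> weyl_C2"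

text \<open>Entire functions of two complex variables: the Frechet derivative exists at every point
  and is linear over the complex numbers.\<close>

definition entire2 :: "(weight \<Rightarrow> complex) \<Rightarrow> bool" where
  "entire2 f \<longleftrightarrow>
     (\<forall>x. \<exists>D. (f has_derivative D) (at x) \<and> Vector_Spaces.linear (*s) (*) D)"

definition S_shift :: "weight \<Rightarrow> (weight \<Rightarrow> complex) \<Rightarrow> weight \<Rightarrow> complex" where
  "S_shift \<beta> f x = f (x + \<beta>)"

text \<open>\<open>S_tau \<tau> \<beta>\<close> is the operator with index \<open>\<tau>\<beta>\<close>.\<close>

definition S_tau :: "complex \<Rightarrow> weight \<Rightarrow> (weight \<Rightarrow> complex) \<Rightarrow> weight \<Rightarrow> complex" where
  "S_tau \<tau> \<beta> f x =
     exp (2 * of_real pi * \<i> * (form x \<beta> + \<tau> * form \<beta> \<beta> / 2)) * f (x + \<tau> *s \<beta>)"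

definition ThW :: "complex \<Rightarrow> (weight \<Rightarrow> complex) set" where
  "ThW \<tau> = {f. entire2 f \<and>
      (\<forall>\<alpha>\<in>coroot_lattice. S_tau \<tau> \<alpha> f = f \<and> S_shift \<alpha> f = f) \<and>
      (\<forall>w\<in>weyl_C2. \<forall>x. f (w x) = f x)}"

definition T_hat :: "complex \<Rightarrow> weight \<Rightarrow> (weight \<Rightarrow> complex) \<Rightarrow> weight \<Rightarrow> complex" where
  "T_hat h p f x = f (x + (2 * h) *s p)"

text \<open>The operators are given by their pointwise formulas. For entire \<open>f\<close> the value at \<open>x\<close>
  is meaningful when no denominator vanishes at \<open>x\<close>, that is, on the sets \<open>M1_regular\<close> and
  \<open>M2_regular\<close>; elsewhere the formulas return junk because of division by zero.\<close>

definition M1 :: "complex \<Rightarrow> complex \<Rightarrow> (weight \<Rightarrow> complex) \<Rightarrow> weight \<Rightarrow> complex" where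
  "M1 \<tau> h f x =
     (\<Sum>p\<in>P1. (\<Prod>q\<in>P1 - {p, - p}. theta \<tau> (form x (p + q) - h) / theta \<tau> (form x (p + q)))
        * T_hat h p f x)"

definition M1_regular :: "complex \<Rightarrow> weight set" where
  "M1_regular \<tau> = {x. \<forall>p\<in>P1. \<forall>q\<in>P1 - {p, - p}. theta \<tau> (form x (p + q)) \<noteq> 0}"

definition M2 :: "complex \<Rightarrow> complex \<Rightarrow> (weight \<Rightarrow> complex) \<Rightarrow> weight \<Rightarrow> complex" where
  "M2 \<tau> h f x =
     (\<Sum>p\<in>{eps 1, - eps 1}. \<Sum>q\<in>{eps 2, - eps 2}.
        theta \<tau> (form x (p + q) - h) / theta \<tau> (form x (p + q) + h)
          * T_hat h p (T_hat h q f) x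
      + theta \<tau> (2 * h) / theta \<tau> (6 * h)
          * (theta \<tau> (2 * form x p + 2 * h) / theta \<tau> (2 * form x p))
          * (theta \<tau> (2 * form x q + 2 * h) / theta \<tau> (2 * form x q))
          * (theta \<tau> (form x (p + q) - 5 * h) / theta \<tau> (form x (p + q) + h))
          * (theta \<tau> (form x (p + q) + 2 * h) / theta \<tau> (form x (p + q)))
          * f x)"

definition M2_regular :: "complex \<Rightarrow> complex \<Rightarrow> weight set" where
  "M2_regular \<tau> h = {x. \<forall>p\<in>{eps 1, - eps 1}. \<forall>q\<in>{eps 2, - eps 2}.
      theta \<tau> (form x (p + q) + h) \<noteq> 0 \<and> theta \<tau> (form x (p + q)) \<noteq> 0 \<and>
      theta \<tau> (2 * form x p) \<noteq> 0 \<and> theta \<tau> (2 * form x q) \<noteq> 0}"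

text \<open>The meromorphic function given by the formula \<open>F\<close> off the zero set of its denominators,
  the complement of \<open>D\<close>, is the everywhere defined function \<open>g\<close>. Density of \<open>D\<close> makes a
  continuous \<open>g\<close> unique.\<close>

definition meromorphic_equals ::
    "weight set \<Rightarrow> (weight \<Rightarrow> complex) \<Rightarrow> (weight \<Rightarrow> complex) \<Rightarrow> bool" where
  "meromorphic_equals D F g \<longleftrightarrow> open D \<and> closure D = UNIV \<and> (\<forall>x\<in>D. F x = g x)"

end

theory Submission
  imports Defs "HOL-Complex_Analysis.Complex_Analysis"
begin

unbundle no fps_syntax

text \<open>In the coordinates \<open>a = x $ 1\<close>, \<open>b = x $ 2\<close> put \<open>u = (a + b) / 2\<close> and \<open>v = (a - b) / 2\<close>. The coefficients
  are chosen so that \<open>M1 f\<close> and \<open>M2 f\<close> have the same quasi-periodicity and Weyl symmetry as \<open>f\<close>; only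
  holomorphy is in question. The possible poles are simple and lie where theta vanishes at \<open>u\<close>, \<open>v\<close>
  (for both operators) and at \<open>a\<close>, \<open>b\<close>, \<open>u \<plusminus> h\<close>, \<open>v \<plusminus> h\<close> (for \<open>M2\<close>). Multiplied by the common
  denominator the functions become entire, and on each of these hyperplanes the surviving terms of the
  numerator cancel in pairs: on \<open>u = \<omega>\<close> by the reflection in that hyperplane, and on \<open>u + h = \<omega>\<close>
  between the shift term and the multiplication term, which fixes the factor \<open>[2h] / [6h]\<close>. Dividing by
  the theta factors one at a time (the hyperplanes are pairwise transversal or disjoint) leaves an
  entire function, by Osgood's lemma and the maximum principle.\<close>

section \<open>Entire functions of two variables\<close>

text \<open>Why the quasi-periods agree: when theta arguments in numerator and denominator move by
  the same lattice point, the quotient picks up a multiplier that depends only on the difference of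
  the arguments. The offsets by multiples of h in each summand, counted together with the shift of f
  by 2h, add up to zero; the numbers 5 and 2 in \<open>M2\<close> satisfy this balance. Origin of
  the constant: on u + h = \<omega> the points (a, b) and (a + 2h, b + 2h) are mirror images in u =
  \<omega>, so f takes the same value at both up to a multiplier. Up to multipliers the quotients in
  a and b multiply to 1, and what remains is [-2h] against c [-6h] [h] / [-h]. The obstacle is the
  repeated division. After one factor is removed, nothing is known directly about the quotient where
  its zero set meets the other walls, so vanishing must be carried over by continuity. This is why
  transversality matters; for parallel walls it amounts to [h] and [2h] being nonzero.\<close>

text \<open>Joint continuity is built in, so that Osgood's elementary lemma suffices in place of
  Hartogs' theorem.\<close>

definition sep_holo :: "(complex \<Rightarrow> complex \<Rightarrow> complex) \<Rightarrow> bool" where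
  "sep_holo F \<longleftrightarrow> continuous_on UNIV (\<lambda>z. F (fst z) (snd z)) \<and>
     (\<forall>b. (\<lambda>a. F a b) holomorphic_on UNIV) \<and> (\<forall>a. F a holomorphic_on UNIV)"

text \<open>The tube lemma: over a compact \<open>K\<close> one neighbourhood of \<open>a0\<close>
  serves all \<open>b\<close>. It supplies the uniform estimates on circles and discs below.\<close>

lemma uniformly_near_slice:
  fixes F :: "complex \<Rightarrow> complex \<Rightarrow> complex"
  assumes "continuous_on UNIV (\<lambda>z. F (fst z) (snd z))" "compact K" "e > 0"
  obtains d where "d > 0" "\<And>a b. dist a a0 < d \<Longrightarrow> b \<in> K \<Longrightarrow> norm (F a b - F a0 b) \<le> e"
proof -
  have "continuous_on (UNIV \<times> K) (\<lambda>z. F (fst z) (snd z))"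
    using assms(1) continuous_on_subset by blast
  from continuous_on_prod_compactE[OF this assms(2) UNIV_I[of a0] assms(3)]
  obtain X0 where X0: "a0 \<in> X0" "open X0"
    "\<forall>x\<in>X0 \<inter> UNIV. \<forall>t\<in>K. dist (F (fst (x, t)) (snd (x, t))) (F (fst (a0, t)) (snd (a0, t))) \<le> e"
    by blast
  obtain d where "d > 0" "\<forall>y. dist y a0 < d \<longrightarrow> y \<in> X0"
    using X0(1,2) open_dist by blast
  with X0(3) that show ?thesis by (auto simp: dist_norm)
qed

lemma sep_holo_swap: "sep_holo F \<Longrightarrow> sep_holo (\<lambda>a b. F b a)"
proof -
  assume F: "sep_holo F"
  have "continuous_on UNIV (\<lambda>z. (\<lambda>z. F (fst z) (snd z)) (snd z, fst z))"
    by (rule continuous_on_compose2[of UNIV])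
      (use F in \<open>auto simp: sep_holo_def intro!: continuous_intros\<close>)
  with F show ?thesis by (simp add: sep_holo_def)
qed

text \<open>Cauchy's estimate on the unit circle about \<open>b\<close>, applied to
  \<open>F a - F a0\<close>, turns uniform closeness of the functions into closeness of their
  derivatives.\<close>

lemma isCont_deriv_snd:
  assumes F: "sep_holo F"
  shows "isCont (\<lambda>z. deriv (F (fst z)) (snd z)) (a0, b0)"
  unfolding continuous_at_eps_delta
proof (intro allI impI)
  fix e :: real assume e: "e > 0"
  have cont: "continuous_on UNIV (\<lambda>z. F (fst z) (snd z))" and hol: "\<And>a. F a holomorphic_on UNIV"
    using F by (auto simp: sep_holo_def)
  have "e / 3 > 0" using e by simp
  \<comment> \<open>Radius 2 because \<open>b\<close> stays within distance 1 of \<open>b0\<close>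
    and the circle about \<open>b\<close> has radius 1.\<close>
  obtain d1 where d1: "d1 > 0"
    "\<And>a b. dist a a0 < d1 \<Longrightarrow> b \<in> cball b0 2 \<Longrightarrow> norm (F a b - F a0 b) \<le> e / 3"
    using uniformly_near_slice[OF cont compact_cball \<open>e / 3 > 0\<close>] by metis
  have "isCont (deriv (F a0)) b0"
    using holomorphic_deriv[OF hol open_UNIV] holomorphic_on_imp_continuous_on
      continuous_on_eq_continuous_at open_UNIV by blast
  then obtain d2 where d2: "d2 > 0" "\<And>b. dist b b0 < d2 \<Longrightarrow> dist (deriv (F a0) b) (deriv (F a0) b0) < e / 3"
    using \<open>e / 3 > 0\<close> unfolding continuous_at_eps_delta by blast
  define d where "d = min (min d1 d2) 1"
  show "\<exists>d>0. \<forall>z. dist z (a0, b0) < d \<longrightarrow>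
      dist (deriv (F (fst z)) (snd z)) (deriv (F (fst (a0, b0))) (snd (a0, b0))) < e"
  proof (intro exI conjI allI impI)
    show "d > 0" using d1 d2 by (simp add: d_def)
    fix z :: "complex \<times> complex" assume z: "dist z (a0, b0) < d"
    obtain a b where ab: "z = (a, b)" by (cases z)
    have a: "dist a a0 < d" and b: "dist b b0 < d"
      using z dist_fst_le[of z "(a0, b0)"] dist_snd_le[of z "(a0, b0)"] by (auto simp: ab)
    have "norm ((deriv ^^ 1) (\<lambda>w. F a w - F a0 w) b) \<le> fact 1 * (e / 3) / 1 ^ 1"
    proof (rule Cauchy_inequality)
      show "(\<lambda>w. F a w - F a0 w) holomorphic_on ball b 1"
        by (intro holomorphic_intros holomorphic_on_subset[OF hol]) auto
      show "continuous_on (cball b 1) (\<lambda>w. F a w - F a0 w)"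
        by (intro continuous_intros holomorphic_on_imp_continuous_on holomorphic_on_subset[OF hol]) auto
      fix w assume w: "norm (b - w) = 1"
      have "dist b0 w \<le> dist b0 b + dist b w" by (rule dist_triangle)
      then have "w \<in> cball b0 2" using b w by (auto simp: dist_norm d_def norm_minus_commute)
      then show "norm (F a w - F a0 w) \<le> e / 3" using a d1 by (auto simp: d_def)
    qed simp
    moreover have "deriv (\<lambda>w. F a w - F a0 w) b = deriv (F a) b - deriv (F a0) b"
      by (rule deriv_diff) (meson UNIV_I hol holomorphic_on_imp_differentiable_at open_UNIV)+
    ultimately have "dist (deriv (F a) b) (deriv (F a0) b) \<le> e / 3" by (simp add: dist_norm)
    moreover have "dist (deriv (F a0) b) (deriv (F a0) b0) < e / 3" using b d2 by (auto simp: d_def)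
    ultimately show "dist (deriv (F (fst z)) (snd z)) (deriv (F (fst (a0, b0))) (snd (a0, b0))) < e"
      using dist_triangle[of "deriv (F a) b" "deriv (F a0) b0" "deriv (F a0) b"] e by (simp add: ab)
  qed
qed

text \<open>Osgood's lemma: both partial derivatives exist and one of them is continuous by
  \<open>isCont_deriv_snd\<close>, which is enough for total differentiability.\<close>

lemma has_derivative_sep_holo:
  assumes F: "sep_holo F"
  shows "((\<lambda>z. F (fst z) (snd z)) has_derivative
     (\<lambda>z. deriv (\<lambda>a. F a b0) a0 * fst z + deriv (F a0) b0 * snd z)) (at (a0, b0))"
proof -
  have "((\<lambda>(x, y). F x y) has_derivative
      (\<lambda>(tx, ty). deriv (\<lambda>a. F a b0) a0 * tx + blinfun_mult_right (deriv (F a0) b0) ty))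
      (at (a0, b0) within UNIV \<times> UNIV)"
  proof (rule has_derivative_partialsI[where fy = "\<lambda>x y. blinfun_mult_right (deriv (F x) y)"])
    show "((\<lambda>x. F x b0) has_derivative (*) (deriv (\<lambda>a. F a b0) a0)) (at a0)"
      using F unfolding sep_holo_def has_field_derivative_def[symmetric]
      by (metis UNIV_I holomorphic_derivI open_UNIV)
    show "(F x has_derivative blinfun_apply (blinfun_mult_right (deriv (F x) y))) (at y)" for x y
    proof -
      have "(F x has_field_derivative deriv (F x) y) (at y)"
        using F unfolding sep_holo_def by (metis UNIV_I holomorphic_derivI open_UNIV)
      then show ?thesis unfolding has_field_derivative_def by simp
    qed
    have "isCont (\<lambda>z. blinfun_mult_right (deriv (F (fst z)) (snd z))) (a0, b0)"
      by (rule bounded_linear.isCont[OF bounded_linear_blinfun_mult_right isCont_deriv_snd[OF F]])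
    then show "continuous (at (a0, b0) within UNIV \<times> UNIV)
        (\<lambda>(x, y). blinfun_mult_right (deriv (F x) y))"
      by (simp add: case_prod_unfold)
  qed auto
  then show ?thesis by (simp add: case_prod_unfold)
qed

lemma continuous_on_vector2:
  assumes "continuous_on S f" "continuous_on S g"
  shows "continuous_on S (\<lambda>z. (vector [f z, g z] :: weight))"
proof -
  have eq: "(vector [f z, g z] :: weight) = (\<chi> j. if j = 1 then f z else g z)" for z
    by (auto simp: vec_eq_iff forall_2)
  have "continuous_on S (\<lambda>z. (\<chi> j. if j = 1 then f z else g z) :: weight)"
  proof (intro continuous_on_vec_lambda)
    show "continuous_on S (\<lambda>z. if j = 1 then f z else g z)" for j :: 2
      using assms by (cases "j = 1") auto
  qed
  then show ?thesis unfolding eq .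
qed

lemma vec_eta: "vector [x $ 1, x $ 2] = (x :: weight)"
  by (simp add: vec_eq_iff forall_2)

text \<open>Complex linearity of the Frechet derivative makes the derivative along the line
  multiplication by the complex number \<open>D d\<close>.\<close>

lemma entire2_line:
  assumes "entire2 f"
  shows "(\<lambda>t. f (x + t *s d)) holomorphic_on UNIV"
proof -
  have "\<exists>f'. ((\<lambda>t. f (x + t *s d)) has_field_derivative f') (at t)" for t
  proof -
    obtain D where D: "(f has_derivative D) (at (x + t *s d))" "Vector_Spaces.linear (*s) (*) D"
      using assms unfolding entire2_def by blast
    interpret Vector_Spaces.linear "(*s)" "(*)" D by fact
    have "linear (\<lambda>t. t *s d)"
      by (intro linearI) (auto simp: vec_eq_iff algebra_simps)
    then have "bounded_linear (\<lambda>t. t *s d)" by (simp add: linear_conv_bounded_linear)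
    then have "((\<lambda>t. x + t *s d) has_derivative (\<lambda>t. t *s d)) (at t)"
      by (auto intro!: derivative_eq_intros bounded_linear_imp_has_derivative)
    from has_derivative_compose[OF this D(1)]
    have "((\<lambda>t. f (x + t *s d)) has_derivative (\<lambda>t. D (t *s d))) (at t)" .
    moreover have "(\<lambda>t. D (t *s d)) = (*) (D d)" by (simp add: scale fun_eq_iff mult.commute)
    ultimately show ?thesis unfolding has_field_derivative_def by auto
  qed
  then show ?thesis
    by (simp add: holomorphic_on_def field_differentiable_def)
qed

lemma entire2_imp_continuous: "entire2 f \<Longrightarrow> continuous_on S f"
  unfolding entire2_def
  by (meson continuous_at_imp_continuous_on has_derivative_continuous)

text \<open>Restriction to coordinate lines in one direction, Osgood's lemma in the other. Closure
  properties of \<open>entire2\<close> can then be checked one variable at a time.\<close>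

lemma entire2_iff: "entire2 f \<longleftrightarrow> sep_holo (\<lambda>a b. f (vector [a, b]))"
proof
  assume f: "entire2 f"
  have "continuous_on UNIV (\<lambda>z. (vector [fst z, snd z] :: weight))"
    by (intro continuous_on_vector2 continuous_intros)
  then have "continuous_on UNIV (\<lambda>z. f (vector [fst z, snd z]))"
    by (rule continuous_on_compose2[OF entire2_imp_continuous[OF f, of UNIV]]) auto
  moreover have "(\<lambda>a. f (vector [a, b])) holomorphic_on UNIV" for b
    using entire2_line[OF f, of "vector [0, b]" "vector [1, 0]"]
    by (rule back_subst[where P = "\<lambda>g. g holomorphic_on UNIV"])
      (auto simp: fun_eq_iff vec_eq_iff forall_2 intro!: arg_cong[of _ _ f])
  moreover have "(\<lambda>b. f (vector [a, b])) holomorphic_on UNIV" for a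
    using entire2_line[OF f, of "vector [a, 0]" "vector [0, 1]"]
    by (rule back_subst[where P = "\<lambda>g. g holomorphic_on UNIV"])
      (auto simp: fun_eq_iff vec_eq_iff forall_2 intro!: arg_cong[of _ _ f])
  ultimately show "sep_holo (\<lambda>a b. f (vector [a, b]))" by (simp add: sep_holo_def)
next
  let ?F = "\<lambda>a b. f (vector [a, b])"
  assume F: "sep_holo ?F"
  show "entire2 f" unfolding entire2_def
  proof
    fix x :: weight
    let ?D = "\<lambda>y :: weight. deriv (\<lambda>a. ?F a (x $ 2)) (x $ 1) * y $ 1 + deriv (?F (x $ 1)) (x $ 2) * y $ 2"
    have "((\<lambda>x :: weight. (x $ 1, x $ 2)) has_derivative (\<lambda>x. (x $ 1, x $ 2))) (at x)"
      by (intro has_derivative_Pair bounded_linear_imp_has_derivative bounded_linear_vec_nth)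
    from has_derivative_compose[OF this has_derivative_sep_holo[OF F]]
    have "(f has_derivative ?D) (at x)" by (simp add: vec_eta)
    moreover have "Vector_Spaces.linear (*s) (*) ?D"
      by unfold_locales (auto simp: algebra_simps)
    ultimately show "\<exists>D. (f has_derivative D) (at x) \<and> Vector_Spaces.linear (*s) (*) D" by blast
  qed
qed

section \<open>Division by a function with simple zeros\<close>

text \<open>At a simple zero the difference quotient, completed by the derivative, is continuous and
  nonzero at \<open>z0\<close>, hence nonzero nearby. Points with
  \<open>\<phi> z0 \<noteq> 0\<close> are covered too, so that later arguments can treat every
  centre alike.\<close>

lemma isolated_zero:
  assumes phi: "\<phi> holomorphic_on UNIV" and simple: "\<And>z. \<phi> z = 0 \<Longrightarrow> deriv \<phi> z \<noteq> 0"
  obtains r where "r > 0" "\<And>z. z \<in> cball z0 r \<Longrightarrow> z \<noteq> z0 \<Longrightarrow> \<phi> z \<noteq> 0"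
proof (cases "\<phi> z0 = 0")
  case False
  have "isCont \<phi> z0"
    using phi holomorphic_on_imp_continuous_on continuous_on_eq_continuous_at open_UNIV by blast
  then obtain d where "d > 0" "\<forall>z. dist z0 z < d \<longrightarrow> \<phi> z \<noteq> 0"
    using continuous_at_avoid[of z0 \<phi> 0] False by blast
  then show ?thesis by (intro that[of "d / 2"]) auto
next
  case True
  let ?q = "\<lambda>z. if z = z0 then deriv \<phi> z0 else (\<phi> z - \<phi> z0) / (z - z0)"
  have "?q holomorphic_on UNIV" by (rule pole_lemma_open[OF phi open_UNIV])
  then have "isCont ?q z0"
    using holomorphic_on_imp_continuous_on continuous_on_eq_continuous_at open_UNIV by blast
  then obtain d where d: "d > 0" "\<forall>z. dist z0 z < d \<longrightarrow> ?q z \<noteq> 0"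
    using continuous_at_avoid[of z0 ?q 0] simple[OF True] by auto
  show ?thesis
  proof (rule that[of "d / 2"])
    fix z assume "z \<in> cball z0 (d / 2)" "z \<noteq> z0"
    then have "?q z \<noteq> 0" using d by (intro d(2)[rule_format]) auto
    with \<open>z \<noteq> z0\<close> True show "\<phi> z \<noteq> 0" by auto
  qed (use d in auto)
qed

text \<open>Near a common zero the quotient is that of the two difference quotients, whose
  denominator does not vanish; the value at the zero is the one of l'Hopital's rule.\<close>

lemma holomorphic_simple_quotient:
  assumes phi: "\<phi> holomorphic_on UNIV" and simple: "\<And>z. \<phi> z = 0 \<Longrightarrow> deriv \<phi> z \<noteq> 0"
    and f: "f holomorphic_on UNIV" and van: "\<And>z. \<phi> z = 0 \<Longrightarrow> f z = 0"
  shows "(\<lambda>z. if \<phi> z = 0 then deriv f z / deriv \<phi> z else f z / \<phi> z) holomorphic_on UNIV" (is "?h holomorphic_on _")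
proof -
  have "?h field_differentiable at z0" for z0
  proof -
    obtain r where r: "r > 0" "\<And>z. z \<in> cball z0 r \<Longrightarrow> z \<noteq> z0 \<Longrightarrow> \<phi> z \<noteq> 0"
      using isolated_zero[OF phi simple] by metis
    have "?h holomorphic_on ball z0 r"
    proof (cases "\<phi> z0 = 0")
      case True
      let ?q = "\<lambda>f z. if z = z0 then deriv f z0 else (f z - f z0) / (z - z0)"
      have q: "?q f holomorphic_on ball z0 r" "?q \<phi> holomorphic_on ball z0 r"
        by (rule pole_lemma_open; rule holomorphic_on_subset[OF f] holomorphic_on_subset[OF phi] open_ball; simp)+
      have nz: "?q \<phi> z \<noteq> 0" if "z \<in> ball z0 r" for z
        using that r True simple by auto
      have "(\<lambda>z. ?q f z / ?q \<phi> z) holomorphic_on ball z0 r"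
        by (rule holomorphic_on_divide[OF q nz])
      then show ?thesis
        by (rule holomorphic_transform) (use r True van in \<open>auto split: if_splits\<close>)
    next
      case False
      then have nz: "\<phi> z \<noteq> 0" if "z \<in> ball z0 r" for z using that r by (cases "z = z0") auto
      have "(\<lambda>z. f z / \<phi> z) holomorphic_on ball z0 r"
        by (intro holomorphic_on_divide holomorphic_on_subset[OF f] holomorphic_on_subset[OF phi] nz) auto
      then show ?thesis by (rule holomorphic_transform) (use nz in auto)
    qed
    then show ?thesis using r(1) by (auto intro: holomorphic_on_imp_differentiable_at)
  qed
  then show ?thesis by (simp add: holomorphic_on_def)
qed

text \<open>On a circle around a zero of \<open>\<phi>\<close> the quotient depends continuously on the second variable;
  the maximum principle carries this over to the disc.\<close>

lemma sep_holo_divide: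
  assumes phi: "\<phi> holomorphic_on UNIV" and simple: "\<And>z. \<phi> z = 0 \<Longrightarrow> deriv \<phi> z \<noteq> 0"
    and F: "sep_holo F" and van: "\<And>a b. \<phi> a = 0 \<Longrightarrow> F a b = 0"
  obtains H where "sep_holo H" "\<And>a b. F a b = \<phi> a * H a b"
proof -
  define H where "H = (\<lambda>a b. if \<phi> a = 0 then deriv (\<lambda>z. F z b) a / deriv \<phi> a else F a b / \<phi> a)"
  have contF: "continuous_on UNIV (\<lambda>z. F (fst z) (snd z))" and F1: "\<And>b. (\<lambda>a. F a b) holomorphic_on UNIV"
    and F2: "\<And>a. F a holomorphic_on UNIV"
    using F by (auto simp: sep_holo_def)
  have H1: "(\<lambda>a. H a b) holomorphic_on UNIV" for b
    unfolding H_def by (rule holomorphic_simple_quotient[OF phi simple F1 van])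
  have contphi: "continuous_on S \<phi>" for S
    using phi holomorphic_on_imp_continuous_on continuous_on_subset by blast
  have contswap: "continuous_on UNIV (\<lambda>z. F (snd z) (fst z))"
    using sep_holo_swap[OF F] by (simp add: sep_holo_def)
  have cont: "isCont (\<lambda>z. H (fst z) (snd z)) (a0, b0)" for a0 b0
    unfolding continuous_at_eps_delta
  proof (intro allI impI)
    fix e :: real assume e: "e > 0"
    obtain r where r: "r > 0" "\<And>z. z \<in> cball a0 r \<Longrightarrow> z \<noteq> a0 \<Longrightarrow> \<phi> z \<noteq> 0"
      using isolated_zero[OF phi simple] by metis
    have nz: "\<phi> z \<noteq> 0" if "z \<in> sphere a0 r" for z using that r by auto
    have "continuous_on (sphere a0 r) (\<lambda>z. norm (\<phi> z))"
      by (intro continuous_intros contphi)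
    moreover have "sphere a0 r \<noteq> {}" using r by simp
    ultimately obtain w where w: "w \<in> sphere a0 r" "\<And>z. z \<in> sphere a0 r \<Longrightarrow> norm (\<phi> w) \<le> norm (\<phi> z)"
      using continuous_attains_inf[OF compact_sphere] by metis
    define m where "m = norm (\<phi> w)"
    have m: "m > 0" "\<And>z. z \<in> sphere a0 r \<Longrightarrow> m \<le> norm (\<phi> z)" using w nz by (auto simp: m_def)
    \<comment> \<open>Passing from \<open>F\<close> to \<open>H\<close> on the circle costs at most
      the factor \<open>1 / m\<close>, so the tolerance for \<open>F\<close> is scaled by
      \<open>m\<close>.\<close>
    have em: "e / 3 * m > 0" using e m by simp
    obtain d1 where d1: "d1 > 0"
      "\<And>b a. dist b b0 < d1 \<Longrightarrow> a \<in> sphere a0 r \<Longrightarrow> norm (F a b - F a b0) \<le> e / 3 * m"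
      using uniformly_near_slice[OF contswap compact_sphere em] by metis
    have "isCont (\<lambda>a. H a b0) a0"
      using H1 holomorphic_on_imp_continuous_on continuous_on_eq_continuous_at open_UNIV by blast
    moreover have "e / 3 > 0" using e by simp
    ultimately obtain d2 where d2: "d2 > 0" "\<And>a. dist a a0 < d2 \<Longrightarrow> dist (H a b0) (H a0 b0) < e / 3"
      unfolding continuous_at_eps_delta by blast
    define d where "d = min (min d1 d2) r"
    show "\<exists>d>0. \<forall>z. dist z (a0, b0) < d \<longrightarrow>
        dist (H (fst z) (snd z)) (H (fst (a0, b0)) (snd (a0, b0))) < e"
    proof (intro exI conjI allI impI)
      show "d > 0" using d1 d2 r by (simp add: d_def)
      fix z :: "complex \<times> complex" assume z: "dist z (a0, b0) < d"
      obtain a b where ab: "z = (a, b)" by (cases z)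
      have a: "dist a a0 < d" and b: "dist b b0 < d"
        using z dist_fst_le[of z "(a0, b0)"] dist_snd_le[of z "(a0, b0)"] by (auto simp: ab)
      have "norm (H a b - H a b0) \<le> e / 3"
      proof (rule maximum_modulus_frontier[where S = "cball a0 r" and f = "\<lambda>a. H a b - H a b0"])
        show "(\<lambda>a. H a b - H a b0) holomorphic_on interior (cball a0 r)"
          by (intro holomorphic_intros holomorphic_on_subset[OF H1]) auto
        show "continuous_on (closure (cball a0 r)) (\<lambda>a. H a b - H a b0)"
          by (intro continuous_intros holomorphic_on_imp_continuous_on holomorphic_on_subset[OF H1]) auto
        show "a \<in> cball a0 r" using a by (auto simp: d_def dist_commute)
        fix x assume "x \<in> frontier (cball a0 r)"
        then have x: "x \<in> sphere a0 r" by auto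
        have "norm (H x b - H x b0) = norm (F x b - F x b0) / norm (\<phi> x)"
          using nz[OF x] by (simp add: H_def diff_divide_distrib[symmetric] norm_divide)
        also have "\<dots> \<le> (e / 3 * m) / m"
          using d1(2)[OF _ x, of b] b m(1) m(2)[OF x] em by (intro frac_le) (auto simp: d_def)
        also have "\<dots> = e / 3" using m by simp
        finally show "norm (H x b - H x b0) \<le> e / 3" .
      qed auto
      moreover have "dist (H a b0) (H a0 b0) < e / 3" using a d2 by (auto simp: d_def)
      ultimately show "dist (H (fst z) (snd z)) (H (fst (a0, b0)) (snd (a0, b0))) < e"
        using dist_triangle[of "H a b" "H a0 b0" "H a b0"] e by (simp add: ab dist_norm)
    qed
  qed
  then have contH: "continuous_on UNIV (\<lambda>z. H (fst z) (snd z))"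
    by (auto simp: continuous_on_eq_continuous_at)
  have H2': "H a holomorphic_on UNIV" if "\<phi> a \<noteq> 0" for a
    using that F2[of a] unfolding H_def by (auto intro!: holomorphic_intros)
  have "H a holomorphic_on UNIV" for a
  proof -
    obtain r where r: "r > 0" "\<And>z. z \<in> cball a r \<Longrightarrow> z \<noteq> a \<Longrightarrow> \<phi> z \<noteq> 0"
      using isolated_zero[OF phi simple] by metis
    \<comment> \<open>At a zero \<open>a\<close> the value \<open>H a b\<close> is a derivative in
      the first variable, which says nothing directly about the second. Approaching \<open>a\<close>
      through nonzeros \<open>s n\<close> exhibits \<open>H a\<close> as a locally uniform limit of
      holomorphic functions.\<close>
    define s where "s n = a + of_real (r / real (Suc n))" for n
    have s: "s n \<in> cball a r" "s n \<noteq> a" for n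
      using r by (auto simp: s_def dist_norm field_simps norm_divide norm_mult simp flip: of_nat_Suc)
    have "(\<lambda>n. r / real (Suc n)) \<longlonglongrightarrow> 0"
      using LIMSEQ_Suc[OF lim_const_over_n[of r]] by simp
    then have "(\<lambda>n. a + of_real (r / real (Suc n))) \<longlonglongrightarrow> a + of_real 0"
      by (intro tendsto_intros)
    then have lim: "s \<longlonglongrightarrow> a" by (simp add: s_def[abs_def])
    show ?thesis
    proof (rule holomorphic_uniform_sequence[where f = "\<lambda>n. H (s n)"])
      show "H (s n) holomorphic_on UNIV" for n by (rule H2') (use r s in blast)
      show "\<exists>d>0. cball x d \<subseteq> UNIV \<and> uniform_limit (cball x d) (\<lambda>n. H (s n)) (H a) sequentially" for x
      proof (intro exI conjI)
        show "uniform_limit (cball x 1) (\<lambda>n. H (s n)) (H a) sequentially"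
        proof (rule uniform_limitI)
          fix e :: real assume "e > 0"
          then have "e / 2 > 0" by simp
          obtain d where d: "d > 0" "\<And>z b. dist z a < d \<Longrightarrow> b \<in> cball x 1 \<Longrightarrow> norm (H z b - H a b) \<le> e / 2"
            using uniformly_near_slice[OF contH compact_cball \<open>e / 2 > 0\<close>] by metis
          from lim d(1) have "\<forall>\<^sub>F n in sequentially. dist (s n) a < d" by (rule tendstoD)
          then show "\<forall>\<^sub>F n in sequentially. \<forall>b\<in>cball x 1. dist (H (s n) b) (H a b) < e"
          proof eventually_elim
            case (elim n)
            show ?case
            proof
              fix b assume "b \<in> cball x 1"
              from d(2)[OF elim this] \<open>e > 0\<close> show "dist (H (s n) b) (H a b) < e" by (simp add: dist_norm)
            qed
          qed
        qed
      qed auto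
    qed simp
  qed
  with contH H1 have "sep_holo H" by (simp add: sep_holo_def)
  moreover have "F a b = \<phi> a * H a b" for a b using van by (auto simp: H_def)
  ultimately show ?thesis by (rule that)
qed

section \<open>Affine forms and their walls\<close>

text \<open>Affine forms are represented by coefficient triples so that walls can be collected in
  lists and finite sets and compared by their coefficients.\<close>

definition lin :: "complex \<times> complex \<times> complex \<Rightarrow> weight \<Rightarrow> complex" where
  "lin w x = fst w * x $ 1 + fst (snd w) * x $ 2 + snd (snd w)"

lemma lin_simp [simp]: "lin (p, q, c) x = p * x $ 1 + q * x $ 2 + c"
  by (simp add: lin_def)

definition nondeg :: "complex \<times> complex \<times> complex \<Rightarrow> bool" where
  "nondeg w \<longleftrightarrow> fst w \<noteq> 0 \<or> fst (snd w) \<noteq> 0"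

lemma nondeg_simp [simp]: "nondeg (p, q, c) \<longleftrightarrow> p \<noteq> 0 \<or> q \<noteq> 0"
  by (simp add: nondeg_def)

lemma entire2_add: "entire2 f \<Longrightarrow> entire2 g \<Longrightarrow> entire2 (\<lambda>x. f x + g x)"
  unfolding entire2_iff sep_holo_def by (auto intro!: continuous_intros holomorphic_intros)

lemma entire2_mult: "entire2 f \<Longrightarrow> entire2 g \<Longrightarrow> entire2 (\<lambda>x. f x * g x)"
  unfolding entire2_iff sep_holo_def by (auto intro!: continuous_intros holomorphic_intros)

lemma entire2_const: "entire2 (\<lambda>x. c)"
  unfolding entire2_iff sep_holo_def by (auto intro!: continuous_intros holomorphic_intros)

lemma entire2_sep_holo:
  assumes "sep_holo F"
  shows "entire2 (\<lambda>x. F (x $ 1) (x $ 2))"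
  using assms by (simp add: entire2_iff)

lemma entire2_lin:
  assumes "\<phi> holomorphic_on UNIV"
  shows "entire2 (\<lambda>x. \<phi> (lin w x))"
proof -
  have c: "continuous_on S \<phi>" for S
    using assms holomorphic_on_imp_continuous_on continuous_on_subset by blast
  show ?thesis unfolding entire2_iff sep_holo_def
  proof (intro conjI allI)
    show "continuous_on UNIV (\<lambda>z. \<phi> (lin w (vector [fst z, snd z])))"
      unfolding lin_def vector_2
      by (rule continuous_on_compose2[OF c[of UNIV]]) (auto intro!: continuous_intros)
    show "(\<lambda>a. \<phi> (lin w (vector [a, b]))) holomorphic_on UNIV" for b
      unfolding lin_def vector_2
      by (rule holomorphic_on_compose_gen[OF _ assms, unfolded o_def]) (auto intro!: holomorphic_intros)
    show "(\<lambda>b. \<phi> (lin w (vector [a, b]))) holomorphic_on UNIV" for a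
      unfolding lin_def vector_2
      by (rule holomorphic_on_compose_gen[OF _ assms, unfolded o_def]) (auto intro!: holomorphic_intros)
  qed
qed

lemma entire2_affine:
  assumes f: "entire2 f"
  shows "entire2 (\<lambda>x. f (vector [lin w x, lin w' x]))"
  unfolding entire2_iff sep_holo_def
proof (intro conjI allI)
  show "continuous_on UNIV (\<lambda>z. f (vector [lin w (vector [fst z, snd z]), lin w' (vector [fst z, snd z])]))"
    unfolding lin_def vector_2
    by (rule continuous_on_compose2[OF entire2_imp_continuous[OF f, of UNIV]])
      (auto intro!: continuous_intros continuous_on_vector2)
  show "(\<lambda>a. f (vector [lin w (vector [a, b]), lin w' (vector [a, b])])) holomorphic_on UNIV" for b
    using entire2_line[OF f, of "vector [lin w (vector [0, b]), lin w' (vector [0, b])]" "vector [fst w, fst w']"]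
    by (rule back_subst[where P = "\<lambda>g. g holomorphic_on UNIV"])
      (auto simp: fun_eq_iff vec_eq_iff forall_2 lin_def algebra_simps intro!: arg_cong[of _ _ f])
  show "(\<lambda>b. f (vector [lin w (vector [a, b]), lin w' (vector [a, b])])) holomorphic_on UNIV" for a
    using entire2_line[OF f, of "vector [lin w (vector [a, 0]), lin w' (vector [a, 0])]"
        "vector [fst (snd w), fst (snd w')]"]
    by (rule back_subst[where P = "\<lambda>g. g holomorphic_on UNIV"])
      (auto simp: fun_eq_iff vec_eq_iff forall_2 lin_def algebra_simps intro!: arg_cong[of _ _ f])
qed

text \<open>Division and density rest only on holomorphy and simple zeros; the locale is later
  instantiated with \<open>theta \<tau>\<close>.\<close>

locale simple_zeros =
  fixes \<phi> :: "complex \<Rightarrow> complex"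
  assumes holo: "\<phi> holomorphic_on UNIV"
    and simple: "\<And>z. \<phi> z = 0 \<Longrightarrow> deriv \<phi> z \<noteq> 0"
begin

lemma countable_zeros: "countable {z. \<phi> z = 0}"
proof -
  have "\<exists>z. \<phi> z \<noteq> 0"
    using isolated_zero[OF holo simple, of 0] by (metis centre_in_cball dist_0_norm mem_cball norm_of_real
      abs_of_pos less_eq_real_def of_real_eq_0_iff order_less_irrefl)
  then show ?thesis
    using holomorphic_countable_zeros[OF holo open_UNIV connected_UNIV]
    by (cases "\<phi> constant_on UNIV") (auto simp: constant_on_def)
qed

text \<open>Each pair excludes only the countable preimage of the zero set under an affine map, and
  a disc is uncountable.\<close>

lemma line_avoids_zeros:
  assumes "finite W" "\<And>c k. (c, k) \<in> W \<Longrightarrow> k \<noteq> 0" "e > 0"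
  obtains t where "norm t < e" "\<And>c k. (c, k) \<in> W \<Longrightarrow> \<phi> (c + t * k) \<noteq> 0"
proof -
  let ?B = "\<Union>(c, k)\<in>W. (\<lambda>z. (z - c) / k) ` {z. \<phi> z = 0}"
  have "countable ?B"
    by (intro countable_UN) (use assms(1) countable_zeros countable_finite in \<open>auto simp: case_prod_unfold\<close>)
  then have "\<not> ball 0 e \<subseteq> ?B"
    using uncountable_ball[OF assms(3)] countable_subset by blast
  then obtain t where t: "t \<in> ball 0 e" "t \<notin> ?B" by blast
  show ?thesis
  proof (rule that[of t])
    fix c k assume ck: "(c, k) \<in> W"
    show "\<phi> (c + t * k) \<noteq> 0"
    proof
      assume "\<phi> (c + t * k) = 0"
      then have "t \<in> (\<lambda>z. (z - c) / k) ` {z. \<phi> z = 0}"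
        using assms(2)[OF ck] by (intro image_eqI[of _ _ "c + t * k"]) auto
      with ck t show False by blast
    qed
  qed (use t in auto)
qed

text \<open>Along a direction \<open>d\<close> tangent to no wall in \<open>W\<close>, arbitrarily
  small steps leave all the walls. \<open>S\<close> is kept general so that it may contain further
  conditions that are constant along \<open>d\<close>, as in \<open>closure_wall\<close>.\<close>

lemma closure_direction:
  assumes "finite W" and nz: "\<And>w. w \<in> W \<Longrightarrow> fst w * (d :: weight) $ 1 + fst (snd w) * d $ 2 \<noteq> 0"
    and S: "\<And>t. (\<forall>w\<in>W. \<phi> (lin w (x + t *s d)) \<noteq> 0) \<Longrightarrow> x + t *s d \<in> S"
  shows "x \<in> closure S"
  unfolding closure_approachable
proof (intro allI impI)
  fix e :: real assume e: "e > 0"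
  let ?W = "(\<lambda>w. (lin w x, fst w * d $ 1 + fst (snd w) * d $ 2)) ` W"
  have "e / (norm d + 1) > 0" using e by (intro divide_pos_pos) (auto intro: add_nonneg_pos)
  then obtain t where t: "norm t < e / (norm d + 1)" "\<And>c k. (c, k) \<in> ?W \<Longrightarrow> \<phi> (c + t * k) \<noteq> 0"
    by (rule line_avoids_zeros[of ?W, rotated 2]) (use assms(1) nz in auto)
  have "x + t *s d \<in> S"
  proof (rule S, rule ballI)
    fix w assume "w \<in> W"
    then have "\<phi> (lin w x + t * (fst w * d $ 1 + fst (snd w) * d $ 2)) \<noteq> 0" by (intro t) auto
    then show "\<phi> (lin w (x + t *s d)) \<noteq> 0" by (simp add: lin_def algebra_simps)
  qed
  moreover have "dist (x + t *s d) x < e"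
  proof -
    have "norm (t *s d) = norm t * norm d"
      unfolding norm_vec_def L2_set_def
      by (simp add: norm_mult power_mult_distrib sum_distrib_left[symmetric] real_sqrt_mult)
    also have "\<dots> \<le> norm t * (norm d + 1)" by (intro mult_left_mono) auto
    also have "\<dots> < e" using t(1) by (simp add: pos_less_divide_eq add_nonneg_pos)
    finally show ?thesis by (simp add: dist_norm)
  qed
  ultimately show "\<exists>y\<in>S. dist y x < e" by blast
qed

lemma closure_regular:
  assumes "finite W" "\<And>w. w \<in> W \<Longrightarrow> nondeg w"
  shows "closure {x. \<forall>w\<in>W. \<phi> (lin w x) \<noteq> 0} = UNIV"
proof -
  \<comment> \<open>For \<open>q \<noteq> 0\<close> the direction \<open>(1, s)\<close> is tangent
    to the wall \<open>(p, q, c)\<close> only if \<open>s = - p / q\<close>. For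
    \<open>q = 0\<close> the quotient is 0 by convention, which merely excludes
    \<open>s = 0\<close>; there \<open>p \<noteq> 0\<close> makes every \<open>(1, s)\<close>
    transversal.\<close>
  have "finite ((\<lambda>w. - (fst w / fst (snd w))) ` W)" using assms(1) by simp
  then obtain s :: complex where s: "s \<notin> (\<lambda>w. - (fst w / fst (snd w))) ` W"
    using infinite_UNIV_char_0 ex_new_if_finite by blast
  have "x \<in> closure {x. \<forall>w\<in>W. \<phi> (lin w x) \<noteq> 0}" for x
  proof (rule closure_direction[OF assms(1), of "vector [1, s]"])
    fix w assume w: "w \<in> W"
    then have "s \<noteq> - (fst w / fst (snd w))" using s by blast
    with assms(2)[OF w] show "fst w * (vector [1, s] :: weight) $ 1 + fst (snd w) * (vector [1, s] :: weight) $ 2 \<noteq> 0"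
      by (cases "fst (snd w) = 0") (auto simp: nondeg_def field_simps eq_neg_iff_add_eq_0)
  qed auto
  then show ?thesis by blast
qed

lemma open_regular:
  assumes "finite W"
  shows "open {x. \<forall>w\<in>W. \<phi> (lin w x) \<noteq> 0}"
proof -
  have "{x. \<forall>w\<in>W. \<phi> (lin w x) \<noteq> 0} = (\<Inter>w\<in>W. {x. \<phi> (lin w x) \<noteq> 0})" by auto
  then show ?thesis
    using assms entire2_imp_continuous[OF entire2_lin[OF holo], of UNIV]
    by (auto intro!: open_INT open_Collect_neq continuous_on_const)
qed

text \<open>Tailored to \<open>closure_wall\<close>: the linear parts are independent or the two
  zero sets are disjoint. The second alternative covers parallel walls.\<close>

definition transversal :: "complex \<times> complex \<times> complex \<Rightarrow> complex \<times> complex \<times> complex \<Rightarrow> bool" where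
  "transversal w w' \<longleftrightarrow> fst w * fst (snd w') \<noteq> fst w' * fst (snd w) \<or>
     (\<forall>x. \<phi> (lin w x) = 0 \<longrightarrow> \<phi> (lin w' x) \<noteq> 0)"

text \<open>An affine change of coordinates makes \<open>lin w\<close> the first coordinate and
  reduces the claim to \<open>sep_holo_divide\<close>. The second coordinate is \<open>x $ 2\<close>
  or \<open>x $ 1\<close>, depending on which coefficient of \<open>w\<close> can be
  inverted.\<close>

lemma entire2_divide:
  assumes N: "entire2 N" and w: "nondeg w" and van: "\<And>x. \<phi> (lin w x) = 0 \<Longrightarrow> N x = 0"
  obtains H where "entire2 H" "\<And>x. N x = \<phi> (lin w x) * H x"
proof -
  obtain p q c where pqc: "w = (p, q, c)" by (cases w)
  show ?thesis
  proof (cases "p = 0")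
    case False
    let ?F = "\<lambda>s t. N (vector [(1 / p) * s + (- q / p) * t + (- c / p), 0 * s + 1 * t + 0])"
    have "sep_holo ?F"
      using entire2_affine[OF N, of "(1 / p, - q / p, - c / p)" "(0, 1, 0)"] by (simp add: entire2_iff)
    moreover have "?F s t = 0" if "\<phi> s = 0" for s t
      by (rule van) (use that False in \<open>simp add: pqc field_simps\<close>)
    ultimately obtain H where H: "sep_holo H" "\<And>s t. ?F s t = \<phi> s * H s t"
      using sep_holo_divide[OF holo simple, of ?F] by blast
    show ?thesis
    proof (rule that)
      show "entire2 (\<lambda>x. H (lin w x) (x $ 2))"
        using entire2_affine[OF entire2_sep_holo[OF H(1)], of w "(0, 1, 0)"] by simp
      fix x
      have "vector [(1 / p) * lin w x + (- q / p) * x $ 2 + (- c / p), 0 * lin w x + 1 * x $ 2 + 0] = x"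
        using False by (simp add: vec_eq_iff forall_2 pqc field_simps)
      then show "N x = \<phi> (lin w x) * H (lin w x) (x $ 2)"
        using H(2)[of "lin w x" "x $ 2"] by simp
    qed
  next
    case True
    with w have q: "q \<noteq> 0" by (simp add: pqc)
    let ?F = "\<lambda>s t. N (vector [0 * s + 1 * t + 0, (1 / q) * s + 0 * t + (- c / q)])"
    have "sep_holo ?F"
      using entire2_affine[OF N, of "(0, 1, 0)" "(1 / q, 0, - c / q)"] by (simp add: entire2_iff)
    moreover have "?F s t = 0" if "\<phi> s = 0" for s t
      by (rule van) (use that q True in \<open>simp add: pqc field_simps\<close>)
    ultimately obtain H where H: "sep_holo H" "\<And>s t. ?F s t = \<phi> s * H s t"
      using sep_holo_divide[OF holo simple, of ?F] by blast
    show ?thesis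
    proof (rule that)
      show "entire2 (\<lambda>x. H (lin w x) (x $ 1))"
        using entire2_affine[OF entire2_sep_holo[OF H(1)], of w "(1, 0, 0)"] by simp
      fix x
      have "vector [0 * lin w x + 1 * x $ 1 + 0, (1 / q) * lin w x + 0 * x $ 1 + (- c / q)] = x"
        using q True by (simp add: vec_eq_iff forall_2 pqc field_simps)
      then show "N x = \<phi> (lin w x) * H (lin w x) (x $ 1)"
        using H(2)[of "lin w x" "x $ 1"] by simp
    qed
  qed
qed

lemma closure_wall:
  assumes "transversal w w'" "\<phi> (lin w' x) = 0"
  shows "x \<in> closure {y. \<phi> (lin w' y) = 0 \<and> \<phi> (lin w y) \<noteq> 0}"
proof (cases "fst w * fst (snd w') = fst w' * fst (snd w)")
  case True
  with assms have "\<phi> (lin w x) \<noteq> 0" by (auto simp: transversal_def)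
  with assms show ?thesis by (auto intro: closure_subset[THEN subsetD])
next
  case False
  show ?thesis
  \<comment> \<open>This direction spans the kernel of the linear part of \<open>lin w'\<close>, so
    the path stays on the wall of \<open>w'\<close>; along it \<open>lin w\<close> changes at the
    rate of the determinant, which is nonzero here.\<close>
  proof (rule closure_direction[of "{w}" "vector [fst (snd w'), - fst w']"])
    fix t assume "\<forall>w\<in>{w}. \<phi> (lin w (x + t *s vector [fst (snd w'), - fst w'])) \<noteq> 0"
    moreover have "lin w' (x + t *s vector [fst (snd w'), - fst w']) = lin w' x"
      by (simp add: lin_def algebra_simps)
    ultimately show "x + t *s vector [fst (snd w'), - fst w'] \<in> {y. \<phi> (lin w' y) = 0 \<and> \<phi> (lin w y) \<noteq> 0}"
      using assms by simp
  qed (use False in \<open>auto simp: algebra_simps\<close>)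
qed

text \<open>One factor is divided out at a time. On a later wall the quotient \<open>H1\<close>
  vanishes off the wall of \<open>w\<close> by cancellation, and at the remaining points by
  continuity and \<open>closure_wall\<close>, so the induction hypothesis applies to it.\<close>

lemma entire2_divide_list:
  assumes "entire2 N" "\<And>w. w \<in> set ws \<Longrightarrow> nondeg w"
    and "\<And>w x. w \<in> set ws \<Longrightarrow> \<phi> (lin w x) = 0 \<Longrightarrow> N x = 0"
    and "sorted_wrt transversal ws"
  shows "\<exists>H. entire2 H \<and> (\<forall>x. N x = (\<Prod>w\<leftarrow>ws. \<phi> (lin w x)) * H x)"
  using assms
proof (induction ws arbitrary: N)
  case Nil
  then show ?case by auto
next
  case (Cons w ws)
  obtain H1 where H1: "entire2 H1" "\<And>x. N x = \<phi> (lin w x) * H1 x"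
    using entire2_divide[OF Cons.prems(1) Cons.prems(2)[of w] Cons.prems(3)[of w]]
    by (metis list.set_intros(1))
  have "H1 x = 0" if w': "w' \<in> set ws" "\<phi> (lin w' x) = 0" for w' x
  proof (rule continuous_constant_on_closure[OF entire2_imp_continuous[OF H1(1)]])
    show "x \<in> closure {y. \<phi> (lin w' y) = 0 \<and> \<phi> (lin w y) \<noteq> 0}"
      using closure_wall Cons.prems w' by auto
    show "H1 y = 0" if "y \<in> {y. \<phi> (lin w' y) = 0 \<and> \<phi> (lin w y) \<noteq> 0}" for y
      using that Cons.prems(3)[of w' y] w' H1(2)[of y] by auto
  qed
  then obtain H where "entire2 H" "\<And>x. H1 x = (\<Prod>w\<leftarrow>ws. \<phi> (lin w x)) * H x"
    using Cons.IH[OF H1(1)] Cons.prems by auto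
  then show ?case using H1(2) by (auto simp: mult_ac)
qed

end

text \<open>Existential form of \<open>lin\<close>, so that introduction rules recognise the
  arguments of theta and \<open>f\<close> in \<open>N1\<close> and \<open>N2\<close> as affine
  without naming coefficients.\<close>

definition affine2 :: "(weight \<Rightarrow> complex) \<Rightarrow> bool" where
  "affine2 g \<longleftrightarrow> (\<exists>w. g = lin w)"

lemma affine2_intros:
  "affine2 (\<lambda>x. c)" "affine2 (\<lambda>x. x $ 1)" "affine2 (\<lambda>x. x $ 2)"
  "affine2 g \<Longrightarrow> affine2 k \<Longrightarrow> affine2 (\<lambda>x. g x + k x)"
  "affine2 g \<Longrightarrow> affine2 k \<Longrightarrow> affine2 (\<lambda>x. g x - k x)"
  "affine2 g \<Longrightarrow> affine2 (\<lambda>x. g x / c)"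
proof -
  show "affine2 (\<lambda>x. c)" unfolding affine2_def by (rule exI[of _ "(0, 0, c)"]) (simp add: fun_eq_iff)
  show "affine2 (\<lambda>x. x $ 1)" unfolding affine2_def by (rule exI[of _ "(1, 0, 0)"]) (simp add: fun_eq_iff)
  show "affine2 (\<lambda>x. x $ 2)" unfolding affine2_def by (rule exI[of _ "(0, 1, 0)"]) (simp add: fun_eq_iff)
  show "affine2 (\<lambda>x. g x + k x)" if "affine2 g" "affine2 k"
  proof -
    from that obtain w w' where "g = lin w" "k = lin w'" by (auto simp: affine2_def)
    then show ?thesis unfolding affine2_def
      by (intro exI[of _ "(fst w + fst w', fst (snd w) + fst (snd w'), snd (snd w) + snd (snd w'))"])
        (simp add: fun_eq_iff lin_def algebra_simps)
  qed
  show "affine2 (\<lambda>x. g x - k x)" if "affine2 g" "affine2 k"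
  proof -
    from that obtain w w' where "g = lin w" "k = lin w'" by (auto simp: affine2_def)
    then show ?thesis unfolding affine2_def
      by (intro exI[of _ "(fst w - fst w', fst (snd w) - fst (snd w'), snd (snd w) - snd (snd w'))"])
        (simp add: fun_eq_iff lin_def algebra_simps)
  qed
  show "affine2 (\<lambda>x. g x / c)" if "affine2 g"
  proof -
    from that obtain w where "g = lin w" by (auto simp: affine2_def)
    then show ?thesis unfolding affine2_def
      by (intro exI[of _ "(fst w / c, fst (snd w) / c, snd (snd w) / c)"])
        (simp add: fun_eq_iff lin_def add_divide_distrib)
  qed
qed

section \<open>The theta function\<close>

text \<open>The q-Pochhammer symbol (pz; p)_infinity.\<close>

definition qprod :: "complex \<Rightarrow> complex \<Rightarrow> complex" where
  "qprod p z = (\<Prod>m. 1 - p ^ Suc m * z)"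

lemma convergent_qprod:
  fixes p z :: complex
  assumes "norm p < 1"
  shows "convergent_prod (\<lambda>m. 1 - p ^ Suc m * z)"
proof -
  have "summable (\<lambda>m. norm p ^ m * (norm p * norm z))"
    using summable_mult2[OF summable_geometric[of "norm p"]] assms by simp
  then have "summable (\<lambda>m. norm (p ^ Suc m * z))"
    by (simp add: norm_mult norm_power mult_ac)
  then have "abs_convergent_prod (\<lambda>m. 1 - p ^ Suc m * z)"
    by (simp add: abs_convergent_prod_conv_summable)
  then show ?thesis by (rule abs_convergent_prod_imp_convergent_prod)
qed

lemma qprod_lim:
  assumes "norm p < 1"
  shows "(\<lambda>n. \<Prod>m<n. 1 - p ^ Suc m * z) \<longlonglongrightarrow> qprod p z"
  using convergent_prod_LIMSEQ[OF convergent_qprod[OF assms]]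
  by (simp add: LIMSEQ_lessThan_iff_atMost qprod_def)

text \<open>A convergent infinite product tends to 0 only if one of its factors vanishes.\<close>

lemma qprod_zero_iff:
  assumes "norm p < 1"
  shows "qprod p z = 0 \<longleftrightarrow> (\<exists>m. p ^ Suc m * z = 1)"
proof -
  let ?f = "\<lambda>m. 1 - p ^ Suc m * z"
  have lim: "(\<lambda>n. \<Prod>m\<le>n. ?f m) \<longlonglongrightarrow> qprod p z"
    using convergent_prod_LIMSEQ[OF convergent_qprod[OF assms]] by (simp only: qprod_def)
  have "qprod p z = 0 \<longleftrightarrow> (\<lambda>n. \<Prod>m\<le>n. ?f m) \<longlonglongrightarrow> 0"
  proof
    assume "qprod p z = 0"
    with lim show "(\<lambda>n. \<Prod>m\<le>n. ?f m) \<longlonglongrightarrow> 0" by (simp only:)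
  next
    assume "(\<lambda>n. \<Prod>m\<le>n. ?f m) \<longlonglongrightarrow> 0"
    then show "qprod p z = 0" by (rule LIMSEQ_unique[OF lim])
  qed
  also have "\<dots> \<longleftrightarrow> (\<exists>m. ?f m = 0)"
    by (rule convergent_prod_to_zero_iff[OF convergent_qprod[OF assms]])
  also have "\<dots> \<longleftrightarrow> (\<exists>m. p ^ Suc m * z = 1)"
    by (simp only: right_minus_eq eq_commute[of 1])
  finally show ?thesis .
qed

text \<open>Splitting off the first factor; this is the source of the quasi-period \<tau> of
  theta.\<close>

lemma qprod_shift:
  assumes "norm p < 1"
  shows "qprod p z = (1 - p * z) * qprod p (p * z)"
proof (rule LIMSEQ_unique)
  show "(\<lambda>n. \<Prod>m<Suc n. 1 - p ^ Suc m * z) \<longlonglongrightarrow> qprod p z"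
    by (rule LIMSEQ_Suc[OF qprod_lim[OF assms]])
  have "(\<lambda>n. (1 - p * z) * (\<Prod>m<n. 1 - p ^ Suc m * (p * z))) \<longlonglongrightarrow> (1 - p * z) * qprod p (p * z)"
    by (intro tendsto_intros qprod_lim assms)
  then show "(\<lambda>n. \<Prod>m<Suc n. 1 - p ^ Suc m * z) \<longlonglongrightarrow> (1 - p * z) * qprod p (p * z)"
    by (simp add: prod.lessThan_Suc_shift mult_ac del: prod.lessThan_Suc)
qed

lemma qprod_holomorphic:
  assumes p: "norm p < 1"
  shows "qprod p holomorphic_on UNIV"
proof (rule holomorphic_uniform_sequence[where f = "\<lambda>n z. \<Prod>m<n. 1 - p ^ Suc m * z"])
  show "(\<lambda>z. \<Prod>m<n. 1 - p ^ Suc m * z) holomorphic_on UNIV" for n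
    by (intro holomorphic_intros)
  fix x :: complex
  show "\<exists>d>0. cball x d \<subseteq> UNIV \<and>
      uniform_limit (cball x d) (\<lambda>n z. \<Prod>m<n. 1 - p ^ Suc m * z) (qprod p) sequentially"
  proof (intro exI conjI)
    let ?M = "norm x + 1"
    have M: "norm z \<le> ?M" if "z \<in> cball x 1" for z
      using that norm_triangle_ineq2[of z x] by (simp add: dist_norm norm_minus_commute)
    have "uniformly_convergent_on (cball x 1) (\<lambda>n z. \<Sum>m<n. norm (1 - p ^ Suc m * z - 1))"
    proof (rule Weierstrass_m_test')
      show "summable (\<lambda>n. norm p ^ n * (norm p * ?M))"
        using summable_mult2[OF summable_geometric[of "norm p"]] p by simp
      show "norm (norm (1 - p ^ Suc n * z - 1)) \<le> norm p ^ n * (norm p * ?M)" if "z \<in> cball x 1" for n z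
      proof -
        have "norm (norm (1 - p ^ Suc n * z - 1)) = norm p ^ n * (norm p * norm z)"
          by (simp add: norm_mult norm_power)
        also have "\<dots> \<le> norm p ^ n * (norm p * ?M)"
          by (intro mult_left_mono M[OF that]) auto
        finally show ?thesis .
      qed
    qed
    then have "uniformly_convergent_on (cball x 1) (\<lambda>n z. \<Prod>m<n. 1 - p ^ Suc m * z)"
      by (intro uniformly_convergent_on_prod' continuous_intros compact_cball)
    then obtain g where g: "uniform_limit (cball x 1) (\<lambda>n z. \<Prod>m<n. 1 - p ^ Suc m * z) g sequentially"
      by (auto simp: uniformly_convergent_on_def)
    have "g z = qprod p z" if "z \<in> cball x 1" for z
      using tendsto_uniform_limitI[OF g that] qprod_lim[OF p] LIMSEQ_unique by blast
    then have "uniform_limit (cball x 1) (\<lambda>n z. \<Prod>m<n. 1 - p ^ Suc m * z) g sequentially \<longleftrightarrow>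
        uniform_limit (cball x 1) (\<lambda>n z. \<Prod>m<n. 1 - p ^ Suc m * z) (qprod p) sequentially"
      by (intro uniform_limit_cong' refl)
    then show "uniform_limit (cball x 1) (\<lambda>n z. \<Prod>m<n. 1 - p ^ Suc m * z) (qprod p) sequentially"
      using g by blast
  qed auto
qed simp

section \<open>Factorisation, quasi-periods and zeros of theta\<close>

locale upper_half =
  fixes \<tau> :: complex
  assumes Im_pos: "Im \<tau> > 0"
begin

definition nome :: complex where "nome = exp (2 * of_real pi * \<i> * \<tau>)"

definition ex :: "complex \<Rightarrow> complex" where "ex u = exp (2 * of_real pi * \<i> * u)"

definition th0 :: complex where
  "th0 = \<i> * exp (of_real pi * \<i> * \<tau> / 4) * qprod nome 1"

lemma ex_add: "ex (u + v) = ex u * ex v" by (simp add: ex_def exp_add algebra_simps)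
lemma ex_minus: "ex (- u) = inverse (ex u)" by (simp add: ex_def exp_minus)
lemma ex_nz [simp]: "ex u \<noteq> 0" by (simp add: ex_def)

lemma nome_nz [simp]: "nome \<noteq> 0" by (simp add: nome_def)

lemma norm_nome: "norm nome < 1"
  using Im_pos by (simp add: nome_def)

text \<open>Each quadratic factor splits as \<open>(1 - y * ex u) * (1 - y * ex (- u))\<close> with
  \<open>y\<close> a power of the nome, and the three resulting products converge
  separately.\<close>

lemma theta_qprod:
  "theta \<tau> u = th0 * sin (of_real pi * u) * qprod nome (ex u) * qprod nome (ex (- u))"
proof -
  have c: "2 * cos (2 * of_real pi * u) = ex u + ex (- u)"
    by (simp add: ex_def cos_exp_eq mult_ac)
  have "(1 - 2 * nome ^ Suc m * cos (2 * of_real pi * u) + nome ^ (2 * Suc m)) =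
      (1 - nome ^ Suc m * ex u) * (1 - nome ^ Suc m * ex (- u))" for m
  proof -
    have "ex u * ex (- u) = 1" by (simp add: ex_minus)
    moreover have "(1 - y * a) * (1 - y * b) = 1 - y * (a + b) + y * y * (a * b)" for y a b :: complex
      by (simp add: algebra_simps)
    ultimately have "(1 - nome ^ Suc m * ex u) * (1 - nome ^ Suc m * ex (- u))
        = 1 - nome ^ Suc m * (ex u + ex (- u)) + nome ^ Suc m * nome ^ Suc m"
      by (simp only: mult_1_right)
    also have "\<dots> = 1 - nome ^ Suc m * (2 * cos (2 * of_real pi * u)) + nome ^ (2 * Suc m)"
    proof -
      have "nome ^ (2 * Suc m) = nome ^ Suc m * nome ^ Suc m" by (simp only: mult_2 power_add)
      then show ?thesis by (simp only: c)
    qed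
    finally show ?thesis by (simp add: mult_ac)
  qed
  then have "(\<Prod>m. (1 - 2 * nome ^ Suc m * cos (2 * of_real pi * u) + nome ^ (2 * Suc m)) * (1 - nome ^ Suc m))
      = (\<Prod>m. ((1 - nome ^ Suc m * ex u) * (1 - nome ^ Suc m * ex (- u))) * (1 - nome ^ Suc m * 1))"
    by simp
  also have "\<dots> = qprod nome (ex u) * qprod nome (ex (- u)) * qprod nome 1"
    unfolding qprod_def using convergent_qprod[OF norm_nome]
    by (simp only: prodinf_mult convergent_prod_mult)
  finally show ?thesis
    unfolding theta_def nome_def[symmetric] th0_def Let_def by (simp only: mult_ac)
qed

lemma th0_nz: "th0 \<noteq> 0"
proof -
  have "nome ^ Suc m * 1 \<noteq> 1" for m
  proof
    assume "nome ^ Suc m * 1 = 1"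
    then have "norm nome ^ Suc m = 1" by (metis mult.right_neutral norm_one norm_power)
    moreover have "norm nome ^ Suc m < 1" by (intro power_Suc_less_one norm_nome) auto
    ultimately show False by simp
  qed
  then have "qprod nome 1 \<noteq> 0" using qprod_zero_iff[OF norm_nome, of 1] by blast
  then show ?thesis by (simp add: th0_def)
qed

lemma theta_minus [simp]: "theta \<tau> (- u) = - theta \<tau> u"
  by (simp only: theta_qprod mult_minus_right sin_minus minus_minus mult_minus_left mult_ac)

lemma theta_zero [simp]: "theta \<tau> 0 = 0"
  by (simp only: theta_qprod mult_zero_right sin_zero mult_zero_left)

lemma qprod_ex_holomorphic:
  "(\<lambda>u. qprod nome (ex u)) holomorphic_on UNIV" "(\<lambda>u. qprod nome (ex (- u))) holomorphic_on UNIV"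
proof -
  have h: "(\<lambda>u. qprod nome (g u)) holomorphic_on UNIV" if "g holomorphic_on UNIV" for g
    using holomorphic_on_compose_gen[OF that qprod_holomorphic[OF norm_nome]] by (simp add: o_def)
  have e: "ex holomorphic_on UNIV" "(\<lambda>u. ex (- u)) holomorphic_on UNIV"
    unfolding ex_def[abs_def] by (intro holomorphic_intros)+
  show "(\<lambda>u. qprod nome (ex u)) holomorphic_on UNIV" "(\<lambda>u. qprod nome (ex (- u))) holomorphic_on UNIV"
    by (rule h[OF e(1)], rule h[OF e(2)])
qed

lemma theta_holomorphic: "theta \<tau> holomorphic_on UNIV"
proof -
  have "(\<lambda>u. th0 * sin (of_real pi * u) * qprod nome (ex u) * qprod nome (ex (- u))) holomorphic_on UNIV"
    by (intro holomorphic_intros qprod_ex_holomorphic)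
  then show ?thesis by (simp add: theta_qprod[abs_def])
qed

lemma theta_add_1: "theta \<tau> (u + 1) = - theta \<tau> u"
proof -
  have e1: "ex 1 = 1" by (simp add: ex_def exp_eq_1)
  have "ex (u + 1) = ex u" "ex (- (u + 1)) = ex (- u)"
    by (simp_all add: ex_add ex_minus e1 del: minus_add_distrib)
  moreover have "sin (of_real pi * (u + 1)) = - sin (of_real pi * u)"
    by (simp add: distrib_left sin_add)
  ultimately show ?thesis by (simp add: theta_qprod)
qed

text \<open>Brings out \<open>1 - ex u\<close>, the factor with exponent 0 that
  \<open>qprod nome (ex u)\<close> lacks; the shift by \<tau> passes such factors between sine and
  products.\<close>

lemma sin_ex: "sin (of_real pi * u) = \<i> / 2 * exp (- (\<i> * of_real pi * u)) * (1 - ex u)"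
proof -
  define e where "e = exp (\<i> * (of_real pi * u))"
  have "e \<noteq> 0" by (simp add: e_def)
  have "ex u = e * e" by (simp add: e_def ex_def mult_ac flip: exp_add)
  moreover have "exp (- (\<i> * of_real pi * u)) = inverse e" by (simp add: e_def exp_minus mult.assoc)
  moreover have "sin (of_real pi * u) = (e - inverse e) / (2 * \<i>)"
    by (simp add: sin_exp_eq e_def exp_minus)
  moreover have "(e - inverse e) / (2 * \<i>) = \<i> / 2 * inverse e * (1 - e * e)"
    using \<open>e \<noteq> 0\<close> by (simp add: field_simps)
  ultimately show ?thesis by simp
qed

text \<open>The sine factor at \<open>u + \<tau>\<close> completes
  \<open>qprod nome (ex (u + \<tau>))\<close> to \<open>qprod nome (ex u)\<close>, while the other
  product releases \<open>1 - ex (- u)\<close>, which times \<open>- ex u\<close> is the sine factor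
  at \<open>u\<close>.\<close>

lemma theta_add_tau: "theta \<tau> (u + \<tau>) = - exp (- (of_real pi * \<i> * (\<tau> + 2 * u))) * theta \<tau> u"
proof -
  have n: "ex \<tau> = nome" by (simp add: ex_def nome_def)
  have z: "ex (u + \<tau>) = nome * ex u" by (simp add: ex_add n)
  have z': "nome * ex (- (u + \<tau>)) = ex (- u)"
    by (simp add: ex_add ex_minus n del: minus_add_distrib)
  have q1: "qprod nome (ex u) = (1 - ex (u + \<tau>)) * qprod nome (ex (u + \<tau>))"
    using qprod_shift[OF norm_nome, of "ex u"] by (simp add: z)
  have q2: "qprod nome (ex (- (u + \<tau>))) = (1 - ex (- u)) * qprod nome (ex (- u))"
    using qprod_shift[OF norm_nome, of "ex (- (u + \<tau>))"] by (simp only: z')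
  have e: "exp (- (\<i> * of_real pi * (u + \<tau>))) = exp (- (\<i> * of_real pi * u)) * exp (- (of_real pi * \<i> * (\<tau> + 2 * u))) * ex u"
    by (simp add: ex_def flip: exp_add) (simp add: algebra_simps)
  have x: "ex u * (1 - ex (- u)) = - (1 - ex u)" by (simp add: ex_minus right_diff_distrib)
  have "theta \<tau> (u + \<tau>) = th0 * (\<i> / 2) * exp (- (\<i> * of_real pi * (u + \<tau>)))
      * ((1 - ex (u + \<tau>)) * qprod nome (ex (u + \<tau>))) * qprod nome (ex (- (u + \<tau>)))"
    by (simp only: theta_qprod sin_ex mult_ac)
  also have "\<dots> = th0 * (\<i> / 2) * exp (- (\<i> * of_real pi * u)) * exp (- (of_real pi * \<i> * (\<tau> + 2 * u)))
      * qprod nome (ex u) * (ex u * (1 - ex (- u))) * qprod nome (ex (- u))"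
    by (simp only: q1[symmetric] q2 e) (simp only: mult_ac)
  also have "\<dots> = - exp (- (of_real pi * \<i> * (\<tau> + 2 * u))) * theta \<tau> u"
    by (simp only: x theta_qprod sin_ex) (simp only: mult_minus_left mult_minus_right mult_ac)
  finally show ?thesis .
qed

definition lat :: "int \<Rightarrow> int \<Rightarrow> complex" where "lat m n = of_int m + of_int n * \<tau>"

text \<open>The part of theta's multiplier under \<open>lat m n\<close> that does not depend on the
  argument; it cancels in quotients, see \<open>theta_ratio\<close>.\<close>

definition jac :: "int \<Rightarrow> int \<Rightarrow> complex" where
  "jac m n = (-1) powi (m + n) * exp (- (of_real pi * \<i> * of_int n ^ 2 * \<tau>))"

lemma jac_nz [simp]: "jac m n \<noteq> 0" by (simp add: jac_def)

lemma theta_add_int: "theta \<tau> (u + of_int m) = (-1) powi m * theta \<tau> u"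
proof (induction m arbitrary: u rule: int_induct[where k = 0])
  case base
  then show ?case by simp
next
  case (step1 i)
  have "theta \<tau> (u + of_int (i + 1)) = theta \<tau> ((u + of_int i) + 1)" by (simp add: algebra_simps)
  also have "\<dots> = (-1) powi (i + 1) * theta \<tau> u"
    by (simp only: theta_add_1 step1) (simp add: power_int_add_1)
  finally show ?case .
next
  case (step2 i)
  have "theta \<tau> (u + of_int i) = theta \<tau> ((u + of_int (i - 1)) + 1)" by (simp add: algebra_simps)
  then have "theta \<tau> (u + of_int (i - 1)) = - ((-1) powi i * theta \<tau> u)"
    by (simp only: theta_add_1 step2) simp
  then show ?case by (simp add: power_int_diff)
qed

lemma theta_add_int_tau:
  "theta \<tau> (u + of_int n * \<tau>) = (-1) powi n * exp (- (of_real pi * \<i> * (of_int n ^ 2 * \<tau> + 2 * of_int n * u))) * theta \<tau> u"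
proof (induction n arbitrary: u rule: int_induct[where k = 0])
  case base
  then show ?case by simp
next
  case (step1 i)
  have "theta \<tau> (u + of_int (i + 1) * \<tau>) = theta \<tau> ((u + of_int i * \<tau>) + \<tau>)" by (simp add: algebra_simps)
  also have "\<dots> = (-1) powi (i + 1) * (exp (- (of_real pi * \<i> * (\<tau> + 2 * (u + of_int i * \<tau>)))) *
      exp (- (of_real pi * \<i> * (of_int i ^ 2 * \<tau> + 2 * of_int i * u)))) * theta \<tau> u"
    by (simp only: theta_add_tau step1) (simp add: power_int_add_1)
  also have "exp (- (of_real pi * \<i> * (\<tau> + 2 * (u + of_int i * \<tau>)))) *
      exp (- (of_real pi * \<i> * (of_int i ^ 2 * \<tau> + 2 * of_int i * u))) =
      exp (- (of_real pi * \<i> * (of_int (i + 1) ^ 2 * \<tau> + 2 * of_int (i + 1) * u)))"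
    by (simp flip: exp_add) (simp add: algebra_simps power2_eq_square)
  finally show ?case .
next
  case (step2 i)
  \<comment> \<open>In the downward step the known relation carries the multiplier of one shift on
    its left-hand side; this removes that nonzero exponential.\<close>
  have cancel: "a = - (s * b * t)" if "e \<noteq> 0" "a * e = - (s * (b * e) * t)" for a b e s t :: complex
  proof -
    have "a * e = - (s * b * t) * e" using that(2) by (simp add: mult_ac)
    then show ?thesis using that(1) by (metis mult_right_cancel)
  qed
  have "theta \<tau> (u + of_int i * \<tau>) = theta \<tau> ((u + of_int (i - 1) * \<tau>) + \<tau>)" by (simp add: algebra_simps)
  then have "theta \<tau> (u + of_int (i - 1) * \<tau>) * exp (- (of_real pi * \<i> * (\<tau> + 2 * (u + of_int (i - 1) * \<tau>)))) =
      - ((-1) powi i * exp (- (of_real pi * \<i> * (of_int i ^ 2 * \<tau> + 2 * of_int i * u))) * theta \<tau> u)"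
    by (simp only: theta_add_tau step2) simp
  also have "exp (- (of_real pi * \<i> * (of_int i ^ 2 * \<tau> + 2 * of_int i * u))) =
      exp (- (of_real pi * \<i> * (of_int (i - 1) ^ 2 * \<tau> + 2 * of_int (i - 1) * u))) *
      exp (- (of_real pi * \<i> * (\<tau> + 2 * (u + of_int (i - 1) * \<tau>))))"
    by (simp flip: exp_add) (simp add: algebra_simps power2_eq_square)
  finally have "theta \<tau> (u + of_int (i - 1) * \<tau>) =
      - ((-1) powi i * exp (- (of_real pi * \<i> * (of_int (i - 1) ^ 2 * \<tau> + 2 * of_int (i - 1) * u))) * theta \<tau> u)"
    by (rule cancel[OF exp_not_eq_zero])
  then show ?case by (simp add: power_int_diff)
qed

lemma theta_lat: "theta \<tau> (lat m n + u) = jac m n * ex (- (of_int n * u)) * theta \<tau> u"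
proof -
  have "theta \<tau> (lat m n + u) = theta \<tau> ((u + of_int n * \<tau>) + of_int m)"
    by (simp add: lat_def algebra_simps)
  also have "\<dots> = (-1) powi (m + n) * exp (- (of_real pi * \<i> * (of_int n ^ 2 * \<tau> + 2 * of_int n * u))) * theta \<tau> u"
    by (simp only: theta_add_int theta_add_int_tau) (simp add: power_int_add)
  also have "exp (- (of_real pi * \<i> * (of_int n ^ 2 * \<tau> + 2 * of_int n * u))) =
      exp (- (of_real pi * \<i> * of_int n ^ 2 * \<tau>)) * ex (- (of_int n * u))"
    by (simp add: ex_def flip: exp_add) (simp add: algebra_simps)
  finally show ?thesis by (simp add: jac_def)
qed

text \<open>The sine contributes the lattice points with \<open>n = 0\<close>, the two products
  those with \<open>n < 0\<close> and \<open>n > 0\<close>, since their exponents start at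
  1.\<close>

lemma theta_zero_iff: "theta \<tau> u = 0 \<longleftrightarrow> (\<exists>m n. u = lat m n)"
proof
  assume "\<exists>m n. u = lat m n"
  then show "theta \<tau> u = 0" using theta_lat[of _ _ 0] by auto
next
  have ex1: "\<exists>m. v = of_int m" if "ex v = 1" for v
  proof -
    from that obtain m :: int where "Im v = 0" "Re v = of_int m"
      unfolding ex_def exp_eq_1 by auto
    then have "v = of_int m" by (simp add: complex_eq_iff)
    then show ?thesis ..
  qed
  have np: "nome ^ k = ex (of_nat k * \<tau>)" for k
    by (simp add: nome_def ex_def mult_ac flip: exp_of_nat_mult)
  assume "theta \<tau> u = 0"
  then consider "sin (of_real pi * u) = 0" | "qprod nome (ex u) = 0" | "qprod nome (ex (- u)) = 0"
    using th0_nz by (auto simp: theta_qprod)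
  then show "\<exists>m n. u = lat m n"
  proof cases
    case 1
    then have "ex u = 1" by (simp add: sin_ex)
    with ex1 obtain m where "u = of_int m" by blast
    then show ?thesis by (intro exI[of _ m] exI[of _ 0]) (simp add: lat_def)
  next
    case 2
    then obtain k where "nome ^ Suc k * ex u = 1" using qprod_zero_iff[OF norm_nome] by blast
    then have "ex (of_nat (Suc k) * \<tau> + u) = 1" by (simp only: np ex_add)
    with ex1 obtain m where "of_nat (Suc k) * \<tau> + u = of_int m" by blast
    then show ?thesis
      by (intro exI[of _ m] exI[of _ "- int (Suc k)"]) (simp add: lat_def algebra_simps eq_diff_eq add_eq_0_iff)
  next
    case 3
    then obtain k where "nome ^ Suc k * ex (- u) = 1" using qprod_zero_iff[OF norm_nome] by blast
    then have "ex (of_nat (Suc k) * \<tau> + - u) = 1" by (simp only: np ex_add)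
    with ex1 obtain m where "of_nat (Suc k) * \<tau> + - u = of_int m" by blast
    then show ?thesis
      by (intro exI[of _ "- m"] exI[of _ "int (Suc k)"]) (simp add: lat_def algebra_simps)
  qed
qed

lemma theta_deriv: "(theta \<tau> has_field_derivative deriv (theta \<tau>) u) (at u)"
  using theta_holomorphic holomorphic_derivI open_UNIV by blast

lemma deriv_theta_0: "deriv (theta \<tau>) 0 \<noteq> 0"
proof -
  define Q where "Q u = th0 * qprod nome (ex u) * qprod nome (ex (- u))" for u
  have "Q holomorphic_on UNIV"
    unfolding Q_def[abs_def] by (intro holomorphic_intros qprod_ex_holomorphic)
  then have "(Q has_field_derivative deriv Q 0) (at 0)"
    using holomorphic_derivI open_UNIV by blast
  then have "((\<lambda>u. sin (of_real pi * u) * Q u) has_field_derivative of_real pi * Q 0) (at 0)"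
    by (auto intro!: derivative_eq_intros)
  moreover have "(\<lambda>u. sin (of_real pi * u) * Q u) = theta \<tau>"
    by (simp add: fun_eq_iff theta_qprod Q_def)
  ultimately have "deriv (theta \<tau>) 0 = of_real pi * Q 0" by (simp add: DERIV_imp_deriv)
  moreover have "Q 0 = th0 * qprod nome 1 * qprod nome 1" by (simp add: Q_def ex_def)
  moreover have "qprod nome 1 \<noteq> 0" using th0_nz by (simp add: th0_def)
  ultimately show ?thesis using th0_nz by simp
qed

text \<open>Differentiating \<open>theta_lat\<close> at 0 carries simplicity from 0 to every lattice
  point: as theta vanishes at 0, the derivative of the multiplier drops out.\<close>

lemma deriv_theta_zero: 
  assumes "theta \<tau> u = 0"
  shows "deriv (theta \<tau>) u \<noteq> 0"
proof
  assume d: "deriv (theta \<tau>) u = 0"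
  obtain m n where u: "u = lat m n" using assms theta_zero_iff by blast
  have "((\<lambda>v. theta \<tau> (lat m n + v)) has_field_derivative deriv (theta \<tau>) (lat m n)) (at 0)"
    using DERIV_shift[of "theta \<tau>" "deriv (theta \<tau>) u" 0 u] theta_deriv[of u] by (simp add: u add.commute)
  moreover have "((\<lambda>v. jac m n * ex (- (of_int n * v)) * theta \<tau> v) has_field_derivative jac m n * deriv (theta \<tau>) 0) (at 0)"
    unfolding ex_def by (rule derivative_eq_intros theta_deriv refl | simp)+
  ultimately have "deriv (theta \<tau>) (lat m n) = jac m n * deriv (theta \<tau>) 0"
    by (simp only: theta_lat DERIV_unique)
  with d show False using deriv_theta_0 by (simp add: u)
qed

section \<open>Quasi-periodic functions\<close>

sublocale simple_zeros "theta \<tau>"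
  by unfold_locales (fact theta_holomorphic, fact deriv_theta_zero)

text \<open>The conditions defining \<open>ThW\<close>, reduced to translations by twice a period in the first coordinate
  and generators of the Weyl group.\<close>

definition quasi :: "(complex \<Rightarrow> complex \<Rightarrow> complex) \<Rightarrow> bool" where
  "quasi F \<longleftrightarrow>
     (\<forall>m n a b. F (a + 2 * lat m n) b = ex (- (of_int n * a + of_int n ^ 2 * \<tau>)) * F a b) \<and>
     (\<forall>a b. F b a = F a b) \<and> (\<forall>a b. F (- a) b = F a b)"

lemma quasi_shift: "quasi F \<Longrightarrow> F (a + 2 * lat m n) b = ex (- (of_int n * a + of_int n ^ 2 * \<tau>)) * F a b"
  and quasi_swap: "quasi F \<Longrightarrow> F b a = F a b"
  and quasi_minus1: "quasi F \<Longrightarrow> F (- a) b = F a b"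
  unfolding quasi_def by blast+

lemma quasi_minus2: "quasi F \<Longrightarrow> F a (- b) = F a b"
  using quasi_swap[where F = F and a = a and b = b] quasi_swap[where F = F and a = a and b = "- b"]
    quasi_minus1[where F = F and a = b and b = a] by simp

lemma quasi_shift2: "quasi F \<Longrightarrow> F a (b + 2 * lat m n) = ex (- (of_int n * b + of_int n ^ 2 * \<tau>)) * F a b"
  using quasi_swap[where F = F and a = a and b = b] quasi_swap[where F = F and a = a and b = "b + 2 * lat m n"]
    quasi_shift[where F = F and a = b and b = a] by simp

lemma ex_of_int [simp]: "ex (of_int m) = 1"
  by (simp add: ex_def exp_eq_1)

lemma ThW_imp_quasi:
  assumes f: "f \<in> ThW \<tau>"
  shows "quasi (\<lambda>a b. f (vector [a, b]))"
  unfolding quasi_def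
proof (intro conjI allI)
  have lat: "S_tau \<tau> \<alpha> f = f" "S_shift \<alpha> f = f" if "\<alpha> \<in> coroot_lattice" for \<alpha>
    using f that by (auto simp: ThW_def)
  have cl: "vector [2 * of_int m, 0] \<in> coroot_lattice" for m
    unfolding coroot_lattice_def
    by (rule CollectI, rule exI[of _ m], rule exI[of _ 0])
      (simp add: vec_eq_iff forall_2 eps_def axis_def)
  fix m n :: int and a b :: complex
  have "f (vector [a + 2 * lat m n, b]) = S_shift (vector [2 * of_int m, 0]) f (vector [a + 2 * (of_int n * \<tau>), b])"
    unfolding S_shift_def by (intro arg_cong[of _ _ f]) (simp add: vec_eq_iff forall_2 lat_def algebra_simps)
  also have "\<dots> = f (vector [a + 2 * (of_int n * \<tau>), b])" by (simp only: lat(2)[OF cl])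
  also have "\<dots> = f (vector [a, b] + \<tau> *s vector [2 * of_int n, 0])"
    by (intro arg_cong[of _ _ f]) (simp add: vec_eq_iff forall_2 algebra_simps)
  also have "\<dots> = ex (- (of_int n * a + of_int n ^ 2 * \<tau>)) * S_tau \<tau> (vector [2 * of_int n, 0]) f (vector [a, b])"
  proof -
    \<comment> \<open>The halves in \<open>form\<close> and in \<open>S_tau\<close> turn the coroot
      \<open>2 * n\<close> times \<open>eps 1\<close> into the exponent used in
      \<open>quasi\<close>.\<close>
    have "form (vector [a, b]) (vector [2 * of_int n, 0]) + \<tau> * form (vector [2 * of_int n, 0]) (vector [2 * of_int n, 0]) / 2
        = of_int n * a + of_int n ^ 2 * \<tau>"
      by (simp add: form_def sum_2 power2_eq_square)
    then show ?thesis unfolding S_tau_def ex_def[symmetric] by (simp only: ex_minus) simp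
  qed
  also have "\<dots> = ex (- (of_int n * a + of_int n ^ 2 * \<tau>)) * f (vector [a, b])"
    by (simp only: lat(1)[OF cl])
  finally show "f (vector [a + 2 * lat m n, b]) = ex (- (of_int n * a + of_int n ^ 2 * \<tau>)) * f (vector [a, b])" .
next
  fix a b :: complex
  have "f (transpose_eps (vector [a, b])) = f (vector [a, b])"
    using f by (auto simp: ThW_def intro: weyl_C2.intros)
  moreover have "transpose_eps (vector [a, b]) = vector [b, a]"
    by (simp add: transpose_eps_def vec_eq_iff forall_2 eps_def axis_def)
  ultimately show "f (vector [b, a]) = f (vector [a, b])" by simp
  have "f (sign_change 1 (vector [a, b])) = f (vector [a, b])"
    using f by (auto simp: ThW_def intro: weyl_C2.intros)
  moreover have "sign_change 1 (vector [a, b]) = vector [- a, b]"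
    by (simp add: sign_change_def vec_eq_iff forall_2)
  ultimately show "f (vector [- a, b]) = f (vector [a, b])" by simp
qed

text \<open>Bijectivity is carried along in the induction because the case of \<open>inv w\<close>
  needs surjectivity of \<open>w\<close>.\<close>

lemma weyl_invariant:
  assumes q: "quasi (\<lambda>a b. f (vector [a, b]))" and w: "w \<in> weyl_C2"
  shows "bij w \<and> (\<forall>x. f (w x) = f x)"
  using w
proof induction
  case transpose
  have t: "transpose_eps x = vector [x $ 2, x $ 1]" for x
    by (simp add: transpose_eps_def vec_eq_iff forall_2 eps_def axis_def)
  have "bij transpose_eps"
    by (intro o_bij[of transpose_eps]) (auto simp: t fun_eq_iff vec_eq_iff forall_2)
  moreover have "f (transpose_eps x) = f x" for x
    using quasi_swap[OF q, of "x $ 2" "x $ 1"] by (simp only: t vec_eta)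
  ultimately show ?case by blast
next
  case (sign j)
  have "bij (sign_change j)"
    by (intro o_bij[of "sign_change j"]) (auto simp: fun_eq_iff vec_eq_iff sign_change_def)
  moreover have "f (sign_change j x) = f x" for x
  proof -
    have "sign_change 1 x = vector [- x $ 1, x $ 2]" "sign_change 2 x = vector [x $ 1, - x $ 2]"
      by (auto simp: sign_change_def vec_eq_iff forall_2)
    then have "f (sign_change 1 x) = f (vector [x $ 1, x $ 2])" "f (sign_change 2 x) = f (vector [x $ 1, x $ 2])"
      using quasi_minus1[OF q] quasi_minus2[OF q] by simp_all
    then show ?thesis using exhaust_2[of j] by (auto simp: vec_eta)
  qed
  ultimately show ?case by blast
next
  case id
  show ?case by (intro conjI bij_id allI) simp
next
  case (comp v w)
  then show ?case by (intro conjI bij_comp) simp_all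
next
  case (inv w)
  then have "f (inv w x) = f x" for x
    by (metis bij_is_surj surj_f_inv_f)
  with inv show ?case by (simp add: bij_imp_bij_inv)
qed

text \<open>The coordinate axes are orthogonal for \<open>form\<close>, so a coroot translation
  factors into two coordinate translations whose exponents add up.\<close>

lemma quasi_imp_ThW:
  assumes e: "entire2 f" and q: "quasi (\<lambda>a b. f (vector [a, b]))"
  shows "f \<in> ThW \<tau>"
proof -
  have sh: "f (vector [a + 2 * lat m n, b + 2 * lat m' n']) =
      ex (- (of_int n * a + of_int n ^ 2 * \<tau>)) * ex (- (of_int n' * b + of_int n' ^ 2 * \<tau>)) * f (vector [a, b])"
    for a b m n m' n'
    using quasi_shift[OF q, of a m n "b + 2 * lat m' n'"] quasi_shift2[OF q, of a b m' n'] by simp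
  have "S_tau \<tau> \<alpha> f x = f x \<and> S_shift \<alpha> f x = f x" if mem: "\<alpha> \<in> coroot_lattice" for \<alpha> x
  proof -
    obtain m n where "\<alpha> = of_int m *s (2 *s eps 1) + of_int n *s (2 *s eps 2)"
      using mem unfolding coroot_lattice_def by blast
    then have \<alpha>: "\<alpha> = vector [2 * of_int m, 2 * of_int n]"
      by (simp add: vec_eq_iff forall_2 eps_def axis_def)
    have "S_shift \<alpha> f x = f (vector [x $ 1 + 2 * lat m 0, x $ 2 + 2 * lat n 0])"
      unfolding S_shift_def \<alpha> by (intro arg_cong[of _ _ f]) (simp add: vec_eq_iff forall_2 lat_def)
    then have 1: "S_shift \<alpha> f x = f x" unfolding sh by (simp add: vec_eta ex_def)
    have "x + \<tau> *s \<alpha> = vector [x $ 1 + 2 * lat 0 m, x $ 2 + 2 * lat 0 n]"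
      unfolding \<alpha> by (simp add: vec_eq_iff forall_2 lat_def)
    then have "S_tau \<tau> \<alpha> f x = ex (form x \<alpha> + \<tau> * form \<alpha> \<alpha> / 2) *
        (ex (- (of_int m * x $ 1 + of_int m ^ 2 * \<tau>)) * ex (- (of_int n * x $ 2 + of_int n ^ 2 * \<tau>)) * f (vector [x $ 1, x $ 2]))"
      unfolding S_tau_def ex_def[symmetric] by (simp only: sh)
    also have "\<dots> = ex ((form x \<alpha> + \<tau> * form \<alpha> \<alpha> / 2) + - (of_int m * x $ 1 + of_int m ^ 2 * \<tau>)
        + - (of_int n * x $ 2 + of_int n ^ 2 * \<tau>)) * f x"
      by (simp only: ex_add vec_eta mult.assoc)
    also have "(form x \<alpha> + \<tau> * form \<alpha> \<alpha> / 2) + - (of_int m * x $ 1 + of_int m ^ 2 * \<tau>)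
        + - (of_int n * x $ 2 + of_int n ^ 2 * \<tau>) = 0"
      by (simp add: form_def sum_2 \<alpha> field_simps power2_eq_square)
    finally show ?thesis using 1 by (simp add: ex_def)
  qed
  then show ?thesis
    using e weyl_invariant[OF q] by (auto simp: ThW_def fun_eq_iff)
qed

lemma dense_eqI:
  assumes "finite W" "\<And>w. w \<in> W \<Longrightarrow> nondeg w" and f: "entire2 f" and g: "entire2 g"
    and eq: "\<And>x. \<forall>w\<in>W. theta \<tau> (lin w x) \<noteq> 0 \<Longrightarrow> f x = g x"
  shows "f x = g x"
proof -
  have "f x - g x = 0"
  proof (rule continuous_constant_on_closure[where f = "\<lambda>x. f x - g x"])
    show "x \<in> closure {x. \<forall>w\<in>W. theta \<tau> (lin w x) \<noteq> 0}"
      using closure_regular[OF assms(1,2)] by simp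
    show "continuous_on (closure {x. \<forall>w\<in>W. theta \<tau> (lin w x) \<noteq> 0}) (\<lambda>x. f x - g x)"
      by (intro continuous_on_diff entire2_imp_continuous f g)
  qed (simp add: eq)
  then show ?thesis by simp
qed

text \<open>The identities defining \<open>ThW\<close> pass from the regular set to the extension by density.\<close>

lemma ThW_extension:
  assumes N: "entire2 N" and nd: "\<And>w. w \<in> set ws \<Longrightarrow> nondeg w"
    and van: "\<And>w x. w \<in> set ws \<Longrightarrow> theta \<tau> (lin w x) = 0 \<Longrightarrow> N x = 0"
    and tr: "sorted_wrt transversal ws"
    and R: "\<And>a b. \<forall>w\<in>set ws. theta \<tau> (lin w (vector [a, b])) \<noteq> 0 \<Longrightarrow>
      N (vector [a, b]) = (\<Prod>w\<leftarrow>ws. theta \<tau> (lin w (vector [a, b]))) * R a b"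
    and q: "quasi R"
  shows "\<exists>g\<in>ThW \<tau>. meromorphic_equals {x. \<forall>w\<in>set ws. theta \<tau> (lin w x) \<noteq> 0} (\<lambda>x. R (x $ 1) (x $ 2)) g"
proof -
  obtain H where H: "entire2 H" "\<And>x. N x = (\<Prod>w\<leftarrow>ws. theta \<tau> (lin w x)) * H x"
    using entire2_divide_list[OF N _ _ tr] nd van by metis
  have HR: "H x = R (x $ 1) (x $ 2)" if "\<forall>w\<in>set ws. theta \<tau> (lin w x) \<noteq> 0" for x
  proof -
    have "(\<Prod>w\<leftarrow>ws. theta \<tau> (lin w x)) \<noteq> 0" using that by (auto simp: prod_list_zero_iff)
    moreover have "N x = (\<Prod>w\<leftarrow>ws. theta \<tau> (lin w x)) * R (x $ 1) (x $ 2)"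
      using R[of "x $ 1" "x $ 2"] that by (simp only: vec_eta)
    ultimately show ?thesis using H(2)[of x] by simp
  qed
  \<comment> \<open>\<open>S\<close> pulls walls back along the symmetry in question. Off the walls
    in \<open>W S\<close> both a point and its image are regular, so \<open>HR\<close> applies to
    both.\<close>
  define W where "W S = set ws \<union> S ` set ws" for S :: "complex \<times> complex \<times> complex \<Rightarrow> _"
  have fin: "finite (W S)" for S by (simp add: W_def)
  have "quasi (\<lambda>a b. H (vector [a, b]))"
    unfolding quasi_def
  proof (intro conjI allI)
    fix m n :: int and a b :: complex
    define S where "S = (\<lambda>w :: complex \<times> complex \<times> complex. (fst w, fst (snd w), snd (snd w) + fst w * (2 * lat m n)))"
    have ex_holo: "ex holomorphic_on UNIV" unfolding ex_def[abs_def] by (intro holomorphic_intros)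
    have "H (vector [lin (1, 0, 2 * lat m n) x, lin (0, 1, 0) x]) = ex (lin (- of_int n, 0, - (of_int n ^ 2 * \<tau>)) x) * H x" for x
    proof (rule dense_eqI[OF fin[of S], where f = "\<lambda>x. H (vector [lin (1, 0, 2 * lat m n) x, lin (0, 1, 0) x])"])
      show "nondeg w" if "w \<in> W S" for w
      proof -
        have "nondeg (S w)" if "w \<in> set ws" for w
          using nd[OF that] by (simp add: S_def nondeg_def disj_commute)
        with that nd show ?thesis unfolding W_def by blast
      qed
      fix x assume x: "\<forall>w\<in>W S. theta \<tau> (lin w x) \<noteq> 0"
      have "lin w (vector [lin (1, 0, 2 * lat m n) x, lin (0, 1, 0) x]) = lin (S w) x" for w
        by (simp add: S_def lin_def algebra_simps)
      then have "H (vector [lin (1, 0, 2 * lat m n) x, lin (0, 1, 0) x]) = R (x $ 1 + 2 * lat m n) (x $ 2)"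
        using x by (subst HR) (auto simp: W_def)
      moreover have "H x = R (x $ 1) (x $ 2)" using x by (intro HR) (auto simp: W_def)
      ultimately show "H (vector [lin (1, 0, 2 * lat m n) x, lin (0, 1, 0) x]) =
          ex (lin (- of_int n, 0, - (of_int n ^ 2 * \<tau>)) x) * H x"
        using quasi_shift[OF q] by simp
    qed (intro entire2_affine H(1) entire2_mult entire2_lin ex_holo)+
    from this[of "vector [a, b]"]
    show "H (vector [a + 2 * lat m n, b]) = ex (- (of_int n * a + of_int n ^ 2 * \<tau>)) * H (vector [a, b])"
      by simp
  next
    fix a b :: complex
    define S where "S = (\<lambda>w :: complex \<times> complex \<times> complex. (fst (snd w), fst w, snd (snd w)))"
    have "H (vector [lin (0, 1, 0) x, lin (1, 0, 0) x]) = H x" for x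
    proof (rule dense_eqI[OF fin[of S], where f = "\<lambda>x. H (vector [lin (0, 1, 0) x, lin (1, 0, 0) x])"])
      show "nondeg w" if "w \<in> W S" for w
      proof -
        have "nondeg (S w)" if "w \<in> set ws" for w
          using nd[OF that] by (simp add: S_def nondeg_def disj_commute)
        with that nd show ?thesis unfolding W_def by blast
      qed
      fix x assume x: "\<forall>w\<in>W S. theta \<tau> (lin w x) \<noteq> 0"
      have "lin w (vector [lin (0, 1, 0) x, lin (1, 0, 0) x]) = lin (S w) x" for w
        by (simp add: S_def lin_def algebra_simps)
      then have "H (vector [lin (0, 1, 0) x, lin (1, 0, 0) x]) = R (x $ 2) (x $ 1)"
        using x by (subst HR) (auto simp: W_def)
      moreover have "H x = R (x $ 1) (x $ 2)" using x by (intro HR) (auto simp: W_def)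
      ultimately show "H (vector [lin (0, 1, 0) x, lin (1, 0, 0) x]) = H x"
        using quasi_swap[OF q] by simp
    qed (intro entire2_affine H(1))+
    from this[of "vector [a, b]"] show "H (vector [b, a]) = H (vector [a, b])" by simp
  next
    fix a b :: complex
    define S where "S = (\<lambda>w :: complex \<times> complex \<times> complex. (- fst w, fst (snd w), snd (snd w)))"
    have "H (vector [lin (- 1, 0, 0) x, lin (0, 1, 0) x]) = H x" for x
    proof (rule dense_eqI[OF fin[of S], where f = "\<lambda>x. H (vector [lin (- 1, 0, 0) x, lin (0, 1, 0) x])"])
      show "nondeg w" if "w \<in> W S" for w
      proof -
        have "nondeg (S w)" if "w \<in> set ws" for w
          using nd[OF that] by (simp add: S_def nondeg_def disj_commute)
        with that nd show ?thesis unfolding W_def by blast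
      qed
      fix x assume x: "\<forall>w\<in>W S. theta \<tau> (lin w x) \<noteq> 0"
      have "lin w (vector [lin (- 1, 0, 0) x, lin (0, 1, 0) x]) = lin (S w) x" for w
        by (simp add: S_def lin_def algebra_simps)
      then have "H (vector [lin (- 1, 0, 0) x, lin (0, 1, 0) x]) = R (- x $ 1) (x $ 2)"
        using x by (subst HR) (auto simp: W_def)
      moreover have "H x = R (x $ 1) (x $ 2)" using x by (intro HR) (auto simp: W_def)
      ultimately show "H (vector [lin (- 1, 0, 0) x, lin (0, 1, 0) x]) = H x"
        using quasi_minus1[OF q] by simp
    qed (intro entire2_affine H(1))+
    from this[of "vector [a, b]"] show "H (vector [- a, b]) = H (vector [a, b])" by simp
  qed
  with H(1) have "H \<in> ThW \<tau>" by (rule quasi_imp_ThW)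
  moreover have "meromorphic_equals {x. \<forall>w\<in>set ws. theta \<tau> (lin w x) \<noteq> 0} (\<lambda>x. R (x $ 1) (x $ 2)) H"
    unfolding meromorphic_equals_def
    using open_regular[of "set ws"] closure_regular[of "set ws"] nd HR by simp
  ultimately show ?thesis by blast
qed

section \<open>The operators and their poles\<close>

text \<open>The argument-dependent part of the multiplier in \<open>theta_lat\<close>. It turns sums
  into products, so checks of quasi-periodicity reduce to adding exponents.\<close>

definition rho :: "int \<Rightarrow> complex \<Rightarrow> complex" where "rho n w = ex (- (of_int n * w))"

lemma rho_add: "rho n (x + y) = rho n x * rho n y"
  by (simp add: rho_def flip: ex_add) (simp add: algebra_simps)

lemma rho_minus: "rho n (- x) = inverse (rho n x)"
  by (simp add: rho_def flip: ex_minus)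

lemma rho_diff: "rho n (x - y) = rho n x * inverse (rho n y)"
  using rho_add[of n x "- y"] by (simp add: rho_minus)

lemma rho_nz [simp]: "rho n x \<noteq> 0" by (simp add: rho_def)

lemma rho_of_nat: "rho n (of_nat k * x) = rho n x ^ k"
  by (induction k) (simp_all add: rho_add distrib_right, simp add: rho_def ex_def)

lemma rho_numeral: "rho n (numeral k * x) = rho n x ^ numeral k"
  using rho_of_nat[of n "numeral k" x] by simp

lemmas rho_simps = rho_add rho_diff rho_minus rho_numeral

lemma theta_rho: "theta \<tau> (lat m n + w) = jac m n * rho n w * theta \<tau> w"
  by (simp add: theta_lat rho_def)

lemma theta_ratio: "theta \<tau> (lat m n + w) / theta \<tau> (lat m n + w') = rho n (w - w') * (theta \<tau> w / theta \<tau> w')"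
  by (simp add: theta_rho rho_diff divide_inverse)

lemma quasi_shift_rho: "quasi F \<Longrightarrow> F (a + 2 * lat m n) b = rho n a * (ex (- (of_int n ^ 2 * \<tau>)) * F a b)"
  by (simp add: quasi_shift rho_def flip: ex_add)

text \<open>The right-hand point is the mirror image of the left-hand one in the hyperplane \<open>u = lat m n\<close>.\<close>

lemma quasi_reflect:
  assumes q: "quasi F"
  shows "F (lat m n + s) (lat m n + t) = rho n (s + t) * F (lat m n - t) (lat m n - s)"
proof -
  have "F (lat m n + s) (lat m n + t) = F ((s - lat m n) + 2 * lat m n) ((t - lat m n) + 2 * lat m n)"
    by (simp add: algebra_simps)
  also have "\<dots> = ex (- (of_int n * (s - lat m n) + of_int n ^ 2 * \<tau>)) * (ex (- (of_int n * (t - lat m n) + of_int n ^ 2 * \<tau>))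
      * F (s - lat m n) (t - lat m n))"
    by (simp only: quasi_shift[OF q] quasi_shift2[OF q]) (simp only: mult_ac)
  \<comment> \<open>The terms with \<tau> cancel because \<open>lat m n\<close> contains
    \<open>n * \<tau>\<close>; the leftover integer \<open>2 * n * m\<close> is a period of
    \<open>ex\<close>.\<close>
  also have "\<dots> = ex (- (of_int n * (s + t)) + of_int (2 * n * m)) * F (s - lat m n) (t - lat m n)"
    by (simp only: mult.assoc[symmetric] ex_add[symmetric]) (simp add: lat_def algebra_simps power2_eq_square)
  also have "\<dots> = rho n (s + t) * F (s - lat m n) (t - lat m n)"
    by (simp only: ex_add ex_of_int rho_def mult_1_right)
  also have "F (s - lat m n) (t - lat m n) = F (lat m n - t) (lat m n - s)"
    using quasi_minus1[OF q, of "lat m n - s" "t - lat m n"] quasi_minus2[OF q, of "lat m n - s" "lat m n - t"]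
      quasi_swap[OF q, of "lat m n - t" "lat m n - s"] by simp
  finally show ?thesis .
qed

text \<open>\<open>psi\<close> and \<open>phi\<close> are the summands of \<open>M1\<close> and \<open>M2\<close> for \<open>p = eps 1\<close> and \<open>(p, q) = (eps 1, eps 2)\<close>; the
  other summands are their images under the Weyl group.\<close>

definition psi :: "complex \<Rightarrow> (complex \<Rightarrow> complex \<Rightarrow> complex) \<Rightarrow> complex \<Rightarrow> complex \<Rightarrow> complex" where
  "psi h F a b = theta \<tau> ((a + b) / 2 - h) / theta \<tau> ((a + b) / 2) *
     (theta \<tau> ((a - b) / 2 - h) / theta \<tau> ((a - b) / 2)) * F (a + 2 * h) b"

text \<open>The Weyl group has order 8, but by \<open>psi_minus2\<close> the sign of the second
  argument does not matter, which leaves four summands.\<close>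

definition R1 :: "complex \<Rightarrow> (complex \<Rightarrow> complex \<Rightarrow> complex) \<Rightarrow> complex \<Rightarrow> complex \<Rightarrow> complex" where
  "R1 h F a b = psi h F a b + psi h F (- a) b + psi h F b a + psi h F (- b) a"

definition phi :: "complex \<Rightarrow> complex \<Rightarrow> (complex \<Rightarrow> complex \<Rightarrow> complex) \<Rightarrow> complex \<Rightarrow> complex \<Rightarrow> complex" where
  "phi h c F a b = theta \<tau> ((a + b) / 2 - h) / theta \<tau> ((a + b) / 2 + h) * F (a + 2 * h) (b + 2 * h) +
     c * (theta \<tau> (a + 2 * h) / theta \<tau> a) * (theta \<tau> (b + 2 * h) / theta \<tau> b) *
     (theta \<tau> ((a + b) / 2 - 5 * h) / theta \<tau> ((a + b) / 2 + h)) *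
     (theta \<tau> ((a + b) / 2 + 2 * h) / theta \<tau> ((a + b) / 2)) * F a b"

text \<open>By \<open>phi_swap\<close> sign changes alone exhaust the orbit. The coefficient
  \<open>c\<close> stays free: periodicity and symmetry hold for every value, and only the walls u
  \<plusminus> h and v \<plusminus> h fix it.\<close>

definition R2 :: "complex \<Rightarrow> complex \<Rightarrow> (complex \<Rightarrow> complex \<Rightarrow> complex) \<Rightarrow> complex \<Rightarrow> complex \<Rightarrow> complex" where
  "R2 h c F a b = phi h c F a b + phi h c F a (- b) + phi h c F (- a) b + phi h c F (- a) (- b)"

lemma psi_minus2: "quasi F \<Longrightarrow> psi h F a (- b) = psi h F a b"
  by (simp add: psi_def quasi_minus2 mult_ac)

lemma phi_swap: "quasi F \<Longrightarrow> phi h c F b a = phi h c F a b"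
  using quasi_swap[of F a b] quasi_swap[of F "a + 2 * h" "b + 2 * h"] by (simp add: phi_def add.commute mult_ac)

text \<open>Both \<open>u\<close> and \<open>v\<close> move by \<open>lat m n\<close>. Each theta
  quotient contributes \<open>rho n (- h)\<close>, and together they cancel the surplus
  \<open>rho n (2 * h)\<close> of \<open>F\<close> at \<open>a + 2 * h\<close>.\<close>

lemma psi_shift1:
  assumes q: "quasi F"
  shows "psi h F (a + 2 * lat m n) b = ex (- (of_int n * a + of_int n ^ 2 * \<tau>)) * psi h F a b"
proof -
  have u: "(a + 2 * lat m n + b) / 2 = lat m n + (a + b) / 2" "(a + 2 * lat m n - b) / 2 = lat m n + (a - b) / 2"
    by (simp_all add: field_simps)
  have s: "lat m n + w - h = lat m n + (w - h)" for w by simp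
  have F: "F (a + 2 * lat m n + 2 * h) b = rho n (a + 2 * h) * (ex (- (of_int n ^ 2 * \<tau>)) * F (a + 2 * h) b)"
    using quasi_shift_rho[OF q, of "a + 2 * h" m n b] by (simp add: add_ac)
  have e: "ex (- (of_int n * a + of_int n ^ 2 * \<tau>)) = rho n a * ex (- (of_int n ^ 2 * \<tau>))"
    by (simp add: rho_def flip: ex_add)
  have r: "rho n ((a + b) / 2 - h - (a + b) / 2) * rho n ((a - b) / 2 - h - (a - b) / 2) * rho n (a + 2 * h) = rho n a"
    by (simp flip: rho_add)
  have "psi h F (a + 2 * lat m n) b =
      (rho n ((a + b) / 2 - h - (a + b) / 2) * rho n ((a - b) / 2 - h - (a - b) / 2) * rho n (a + 2 * h)) *
      ex (- (of_int n ^ 2 * \<tau>)) * psi h F a b"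
    unfolding psi_def u s theta_ratio F by (simp only: mult_ac)
  then show ?thesis unfolding r e .
qed

text \<open>Here \<open>u\<close> and \<open>v\<close> move in opposite directions, so the
  multipliers of the two quotients cancel each other.\<close>

lemma psi_shift2:
  assumes q: "quasi F"
  shows "psi h F a (b + 2 * lat m n) = ex (- (of_int n * b + of_int n ^ 2 * \<tau>)) * psi h F a b"
proof -
  define w where "w = (a - b) / 2"
  have u: "(a + (b + 2 * lat m n)) / 2 = lat m n + (a + b) / 2" "(a - (b + 2 * lat m n)) / 2 = w - lat m n"
    by (simp_all add: w_def field_simps)
  have s: "lat m n + w - h = lat m n + (w - h)" for w by simp
  \<comment> \<open>Oddness turns a translation by \<open>- lat m n\<close> into one by
    \<open>lat m n\<close>, so that \<open>theta_ratio\<close> applies.\<close>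
  have "theta \<tau> (w - lat m n - h) = - theta \<tau> (lat m n + (h - w))" "theta \<tau> (w - lat m n) = - theta \<tau> (lat m n + - w)"
    using theta_minus[of "lat m n + (h - w)"] theta_minus[of "lat m n + - w"] by (simp_all add: algebra_simps)
  then have "theta \<tau> (w - lat m n - h) / theta \<tau> (w - lat m n) = rho n (h - w - - w) * (theta \<tau> (h - w) / theta \<tau> (- w))"
    using theta_ratio[of m n "h - w" "- w"] by simp
  also have "\<dots> = rho n h * (theta \<tau> (w - h) / theta \<tau> w)"
    using theta_minus[of "w - h"] by simp
  finally have r: "theta \<tau> (w - lat m n - h) / theta \<tau> (w - lat m n) = rho n h * (theta \<tau> (w - h) / theta \<tau> w)" .
  have r': "rho n ((a + b) / 2 - h - (a + b) / 2) * rho n h = 1"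
    by (simp flip: rho_add) (simp add: rho_def ex_def)
  have "psi h F a (b + 2 * lat m n) = (rho n ((a + b) / 2 - h - (a + b) / 2) * rho n h) *
      ex (- (of_int n * b + of_int n ^ 2 * \<tau>)) * psi h F a b"
    unfolding psi_def u s theta_ratio r quasi_shift2[OF q] unfolding w_def by (simp only: mult_ac)
  then show ?thesis unfolding r' by simp
qed

lemma quasi_R1:
  assumes q: "quasi F"
  shows "quasi (R1 h F)"
  unfolding quasi_def
proof (intro conjI allI)
  fix m n :: int and a b :: complex
  have "psi h F (- (a + 2 * lat m n)) b = psi h F (- a + 2 * lat (- m) (- n)) b"
    by (simp add: lat_def algebra_simps)
  also have "\<dots> = ex (- (of_int n * a + of_int n ^ 2 * \<tau>)) * psi h F (- a) b"
    using psi_shift1[OF q, of h "- a" "- m" "- n" b] by simp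
  finally show "R1 h F (a + 2 * lat m n) b = ex (- (of_int n * a + of_int n ^ 2 * \<tau>)) * R1 h F a b"
    unfolding R1_def by (simp only: psi_shift1[OF q] psi_shift2[OF q] distrib_left)
next
  show "R1 h F b a = R1 h F a b" for a b by (simp add: R1_def)
  show "R1 h F (- a) b = R1 h F a b" for a b by (simp add: R1_def psi_minus2[OF q])
qed

text \<open>In the shift term the quotient contributes -2h and \<open>F\<close> contributes 2h. In
  the multiplication term \<open>a\<close> moves by two lattice points, so its quotient counts 2h
  twice, and 4h - 6h + 2h = 0.\<close>

lemma phi_shift1:
  assumes q: "quasi F"
  shows "phi h c F (a + 2 * lat m n) b = ex (- (of_int n * a + of_int n ^ 2 * \<tau>)) * phi h c F a b"
proof -
  have u: "(a + 2 * lat m n + b) / 2 = lat m n + (a + b) / 2" by (simp add: field_simps)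
  have a: "a + 2 * lat m n = lat (2 * m) (2 * n) + a" "a + 2 * lat m n + 2 * h = lat (2 * m) (2 * n) + (a + 2 * h)"
    by (simp_all add: lat_def algebra_simps)
  have s: "lat m n + w - y = lat m n + (w - y)" "lat m n + w + y = lat m n + (w + y)" for w y by simp_all
  have F1: "F (a + 2 * lat m n + 2 * h) (b + 2 * h) = rho n (a + 2 * h) * (ex (- (of_int n ^ 2 * \<tau>)) * F (a + 2 * h) (b + 2 * h))"
    using quasi_shift_rho[OF q, of "a + 2 * h" m n "b + 2 * h"] by (simp add: add_ac)
  have r: "rho (2 * n) w = rho n w ^ 2" for w
    using rho_numeral[of n "Num.Bit0 Num.One" w] by (simp add: rho_def mult_ac)
  have t1: "theta \<tau> (a + 2 * lat m n + 2 * h) / theta \<tau> (a + 2 * lat m n) = rho n (2 * h) ^ 2 * (theta \<tau> (a + 2 * h) / theta \<tau> a)"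
    unfolding a(2) unfolding a(1) theta_ratio r by simp
  have e: "ex (- (of_int n * a + of_int n ^ 2 * \<tau>)) = rho n a * ex (- (of_int n ^ 2 * \<tau>))"
    by (simp add: rho_def flip: ex_add)
  have r1: "rho n ((a + b) / 2 - h - ((a + b) / 2 + h)) * rho n (a + 2 * h) = rho n a"
    by (simp flip: rho_add)
  have r2: "rho n (2 * h) ^ 2 * rho n ((a + b) / 2 - 5 * h - ((a + b) / 2 + h)) * rho n ((a + b) / 2 + 2 * h - ((a + b) / 2)) = 1"
    by (simp add: power2_eq_square flip: rho_add) (simp add: rho_def ex_def)
  have "phi h c F (a + 2 * lat m n) b =
      (rho n ((a + b) / 2 - h - ((a + b) / 2 + h)) * rho n (a + 2 * h)) * ex (- (of_int n ^ 2 * \<tau>)) *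
        (theta \<tau> ((a + b) / 2 - h) / theta \<tau> ((a + b) / 2 + h) * F (a + 2 * h) (b + 2 * h)) +
      (rho n (2 * h) ^ 2 * rho n ((a + b) / 2 - 5 * h - ((a + b) / 2 + h)) * rho n ((a + b) / 2 + 2 * h - ((a + b) / 2))) *
        (rho n a * ex (- (of_int n ^ 2 * \<tau>))) *
        (c * (theta \<tau> (a + 2 * h) / theta \<tau> a) * (theta \<tau> (b + 2 * h) / theta \<tau> b) *
        (theta \<tau> ((a + b) / 2 - 5 * h) / theta \<tau> ((a + b) / 2 + h)) *
        (theta \<tau> ((a + b) / 2 + 2 * h) / theta \<tau> ((a + b) / 2)) * F a b)"
    unfolding phi_def u s F1 t1 theta_ratio quasi_shift_rho[OF q] by (simp only: mult_ac)
  also have "\<dots> = ex (- (of_int n * a + of_int n ^ 2 * \<tau>)) * phi h c F a b"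
    unfolding r1 r2 phi_def e by (simp only: distrib_left mult_1_left)
  finally show ?thesis .
qed

lemma quasi_R2:
  assumes q: "quasi F"
  shows "quasi (R2 h c F)"
  unfolding quasi_def
proof (intro conjI allI)
  fix m n :: int and a b :: complex
  have "phi h c F (- (a + 2 * lat m n)) b = ex (- (of_int n * a + of_int n ^ 2 * \<tau>)) * phi h c F (- a) b" for b
  proof -
    have "phi h c F (- (a + 2 * lat m n)) b = phi h c F (- a + 2 * lat (- m) (- n)) b"
      by (simp add: lat_def algebra_simps)
    then show ?thesis using phi_shift1[OF q, of h c "- a" "- m" "- n" b] by simp
  qed
  then show "R2 h c F (a + 2 * lat m n) b = ex (- (of_int n * a + of_int n ^ 2 * \<tau>)) * R2 h c F a b"
    unfolding R2_def by (simp only: phi_shift1[OF q] distrib_left)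
next
  fix a b :: complex
  show "R2 h c F b a = R2 h c F a b"
    unfolding R2_def
    using phi_swap[OF q, of h c b a] phi_swap[OF q, of h c b "- a"] phi_swap[OF q, of h c "- b" a]
      phi_swap[OF q, of h c "- b" "- a"] by simp
  show "R2 h c F (- a) b = R2 h c F a b" by (simp add: R2_def)
qed

section \<open>The operators in coordinates\<close>

lemma form_2: "form x y = (x $ 1 * y $ 1 + x $ 2 * y $ 2) / 2"
  by (simp add: form_def sum_2)

lemma eps_nth: "eps 1 $ 1 = 1" "eps 1 $ 2 = 0" "eps 2 $ 1 = 0" "eps 2 $ 2 = 1"
  by (simp_all add: eps_def axis_def)

lemma eps_neq: "eps 1 \<noteq> - eps 1" "eps 1 \<noteq> eps 2" "eps 1 \<noteq> - eps 2" "- eps 1 \<noteq> eps 2"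
  "eps 2 \<noteq> - eps 2" "eps 2 \<noteq> eps 1" "- eps 2 \<noteq> eps 1" "eps 2 \<noteq> - eps 1" "- eps 1 \<noteq> eps 1" "- eps 2 \<noteq> eps 2"
  by (simp_all add: vec_eq_iff forall_2 eps_nth)

lemma P1_minus:
  "P1 - {eps 1, - eps 1} = {eps 2, - eps 2}" "P1 - {- eps 1, - (- eps 1)} = {eps 2, - eps 2}"
  "P1 - {eps 2, - eps 2} = {eps 1, - eps 1}" "P1 - {- eps 2, - (- eps 2)} = {eps 1, - eps 1}"
  using eps_neq by (auto simp: P1_def)

text \<open>Invariance of \<open>f\<close> rewrites a shift by \<open>- 2 * h\<close> at
  \<open>a\<close> as one by \<open>2 * h\<close> at \<open>- a\<close>, which makes every summand a
  value of \<open>psi\<close>. Both sides have the same denominators up to order, so the identity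
  holds at every \<open>x\<close>.\<close>

lemma M1_eq_R1:
  assumes q: "quasi (\<lambda>a b. f (vector [a, b]))"
  shows "M1 \<tau> h f x = R1 h (\<lambda>a b. f (vector [a, b])) (x $ 1) (x $ 2)"
proof -
  let ?F = "\<lambda>a b. f (vector [a, b])"
  have T: "T_hat h (eps 1) f x = ?F (x $ 1 + 2 * h) (x $ 2)" "T_hat h (- eps 1) f x = ?F (- x $ 1 + 2 * h) (x $ 2)"
    "T_hat h (eps 2) f x = ?F (x $ 2 + 2 * h) (x $ 1)" "T_hat h (- eps 2) f x = ?F (- x $ 2 + 2 * h) (x $ 1)"
  proof -
    have v: "x + (2 * h) *s eps 1 = vector [x $ 1 + 2 * h, x $ 2]" "x + (2 * h) *s (- eps 1) = vector [- (- x $ 1 + 2 * h), x $ 2]"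
      "x + (2 * h) *s eps 2 = vector [x $ 1, x $ 2 + 2 * h]" "x + (2 * h) *s (- eps 2) = vector [x $ 1, - (- x $ 2 + 2 * h)]"
      by (simp_all add: vec_eq_iff forall_2 eps_nth)
    show "T_hat h (eps 1) f x = ?F (x $ 1 + 2 * h) (x $ 2)" unfolding T_hat_def v ..
    show "T_hat h (- eps 1) f x = ?F (- x $ 1 + 2 * h) (x $ 2)" unfolding T_hat_def v by (rule quasi_minus1[OF q])
    show "T_hat h (eps 2) f x = ?F (x $ 2 + 2 * h) (x $ 1)" unfolding T_hat_def v by (rule quasi_swap[OF q])
    show "T_hat h (- eps 2) f x = ?F (- x $ 2 + 2 * h) (x $ 1)" unfolding T_hat_def v
      by (simp only: quasi_minus2[OF q]) (rule quasi_swap[OF q])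
  qed
  have sum: "(\<Sum>p\<in>P1. g p) = g (eps 1) + g (- eps 1) + g (eps 2) + g (- eps 2)" for g :: "weight \<Rightarrow> complex"
    unfolding P1_def using eps_neq by (simp add: add.assoc)
  have pr: "(\<Prod>q\<in>{eps j, - eps j}. g q) = g (eps j) * g (- eps j)" if "j = 1 \<or> j = 2" for g :: "weight \<Rightarrow> complex" and j :: 2
    using that eps_neq by auto
  have c: "- x $ 2 - x $ 1 = - x $ 1 - x $ 2" by simp
  show ?thesis
    unfolding M1_def sum P1_minus T by (simp add: pr R1_def psi_def form_2 eps_nth add.commute c)
qed

lemma M2_eq_R2:
  assumes q: "quasi (\<lambda>a b. f (vector [a, b]))"
  shows "M2 \<tau> h f x = R2 h (theta \<tau> (2 * h) / theta \<tau> (6 * h)) (\<lambda>a b. f (vector [a, b])) (x $ 1) (x $ 2)"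
proof -
  let ?F = "\<lambda>a b. f (vector [a, b])"
  have sum: "(\<Sum>q\<in>{eps j, - eps j}. g q) = g (eps j) + g (- eps j)" if "j = 1 \<or> j = 2" for g :: "weight \<Rightarrow> complex" and j :: 2
    using that eps_neq by auto
  have v: "x + (2 * h) *s eps 1 + (2 * h) *s eps 2 = vector [x $ 1 + 2 * h, x $ 2 + 2 * h]"
    "x + (2 * h) *s eps 1 + (2 * h) *s (- eps 2) = vector [x $ 1 + 2 * h, - (- x $ 2 + 2 * h)]"
    "x + (2 * h) *s (- eps 1) + (2 * h) *s eps 2 = vector [- (- x $ 1 + 2 * h), x $ 2 + 2 * h]"
    "x + (2 * h) *s (- eps 1) + (2 * h) *s (- eps 2) = vector [- (- x $ 1 + 2 * h), - (- x $ 2 + 2 * h)]"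
    by (simp_all add: vec_eq_iff forall_2 eps_nth)
  have x: "f x = ?F (x $ 1) (x $ 2)" "f x = ?F (x $ 1) (- x $ 2)" "f x = ?F (- x $ 1) (x $ 2)" "f x = ?F (- x $ 1) (- x $ 2)"
    using quasi_minus1[OF q] quasi_minus2[OF q] by (simp_all add: vec_eta)
  have T: "T_hat h (eps 1) (T_hat h (eps 2) f) x = ?F (x $ 1 + 2 * h) (x $ 2 + 2 * h)"
    "T_hat h (eps 1) (T_hat h (- eps 2) f) x = ?F (x $ 1 + 2 * h) (- x $ 2 + 2 * h)"
    "T_hat h (- eps 1) (T_hat h (eps 2) f) x = ?F (- x $ 1 + 2 * h) (x $ 2 + 2 * h)"
    "T_hat h (- eps 1) (T_hat h (- eps 2) f) x = ?F (- x $ 1 + 2 * h) (- x $ 2 + 2 * h)"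
    unfolding T_hat_def v by (simp_all only: quasi_minus1[OF q] quasi_minus2[OF q])
  have fm: "form x (eps 1 + eps 2) = (x $ 1 + x $ 2) / 2" "form x (eps 1 + - eps 2) = (x $ 1 + - x $ 2) / 2"
    "form x (- eps 1 + eps 2) = (- x $ 1 + x $ 2) / 2" "form x (- eps 1 + - eps 2) = (- x $ 1 + - x $ 2) / 2"
    "2 * form x (eps 1) = x $ 1" "2 * form x (- eps 1) = - x $ 1" "2 * form x (eps 2) = x $ 2" "2 * form x (- eps 2) = - x $ 2"
    by (simp_all add: form_2 eps_nth)
  have s: "(\<Sum>p\<in>{eps 1, - eps 1}. \<Sum>q\<in>{eps 2, - eps 2}. g p q) =
      g (eps 1) (eps 2) + g (eps 1) (- eps 2) + g (- eps 1) (eps 2) + g (- eps 1) (- eps 2)" for g :: "weight \<Rightarrow> weight \<Rightarrow> complex"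
    by (simp add: sum)
  show ?thesis
    unfolding M2_def s T fm R2_def phi_def using x by (simp only:)
qed

section \<open>Entire numerators and their vanishing on the walls\<close>

text \<open>\<open>R1\<close> times its common denominator, see \<open>N1_eq\<close>; written
  without division so that it is entire across the walls.\<close>

definition N1 :: "complex \<Rightarrow> (complex \<Rightarrow> complex \<Rightarrow> complex) \<Rightarrow> complex \<Rightarrow> complex \<Rightarrow> complex" where
  "N1 h F a b = (let u = (a + b) / 2; v = (a - b) / 2 in
     theta \<tau> (u - h) * theta \<tau> (v - h) * F (a + 2 * h) b +
     theta \<tau> (u + h) * theta \<tau> (v + h) * F (a - 2 * h) b +
     theta \<tau> (u - h) * theta \<tau> (v + h) * F a (b + 2 * h) +
     theta \<tau> (u + h) * theta \<tau> (v - h) * F a (b - 2 * h))"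

text \<open>\<open>R2\<close> times the eight theta factors of its denominators, see
  \<open>N2_eq\<close>. The first block holds the shift terms, the second the multiplication
  terms.\<close>

definition N2 :: "complex \<Rightarrow> complex \<Rightarrow> (complex \<Rightarrow> complex \<Rightarrow> complex) \<Rightarrow> complex \<Rightarrow> complex \<Rightarrow> complex" where
  "N2 h c F a b = (let u = (a + b) / 2; v = (a - b) / 2 in
     theta \<tau> a * theta \<tau> b * theta \<tau> u * theta \<tau> v *
       (theta \<tau> (v + h) * theta \<tau> (v - h) *
          (theta \<tau> (u - h) * theta \<tau> (u - h) * F (a + 2 * h) (b + 2 * h) +
           theta \<tau> (u + h) * theta \<tau> (u + h) * F (a - 2 * h) (b - 2 * h)) +
        theta \<tau> (u + h) * theta \<tau> (u - h) *
          (theta \<tau> (v - h) * theta \<tau> (v - h) * F (a + 2 * h) (b - 2 * h) +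
           theta \<tau> (v + h) * theta \<tau> (v + h) * F (a - 2 * h) (b + 2 * h))) +
     c * F a b *
       (theta \<tau> v * theta \<tau> (v + h) * theta \<tau> (v - h) *
          (theta \<tau> (a + 2 * h) * theta \<tau> (b + 2 * h) * theta \<tau> (u - 5 * h) * theta \<tau> (u + 2 * h) * theta \<tau> (u - h) +
           theta \<tau> (a - 2 * h) * theta \<tau> (b - 2 * h) * theta \<tau> (u + 5 * h) * theta \<tau> (u - 2 * h) * theta \<tau> (u + h)) +
        theta \<tau> u * theta \<tau> (u + h) * theta \<tau> (u - h) *
          (theta \<tau> (a + 2 * h) * theta \<tau> (b - 2 * h) * theta \<tau> (v - 5 * h) * theta \<tau> (v + 2 * h) * theta \<tau> (v - h) +
           theta \<tau> (a - 2 * h) * theta \<tau> (b + 2 * h) * theta \<tau> (v + 5 * h) * theta \<tau> (v - 2 * h) * theta \<tau> (v + h))))"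

lemma N1_minus2:
  assumes q: "quasi F"
  shows "N1 h F a (- b) = N1 h F a b"
  using quasi_minus2[OF q, of a "b + 2 * h"] quasi_minus2[OF q, of a "b - 2 * h"]
  by (simp add: N1_def Let_def quasi_minus2[OF q] algebra_simps)

text \<open>Serves to deduce the wall \<open>u - h\<close> from the wall
  \<open>u + h\<close>.\<close>

lemma N2_minus_h: "N2 (- h) c F a b = N2 h c F a b"
  by (simp add: N2_def Let_def algebra_simps)

text \<open>The sign comes from the common denominator, which is odd in \<open>b\<close>. Since the
  sign change exchanges \<open>u\<close> and \<open>v\<close>, the walls in \<open>v\<close> follow
  from those in \<open>u\<close>.\<close>

lemma N2_minus2:
  assumes q: "quasi F"
  shows "N2 h c F a (- b) = - N2 h c F a b"
proof -
  have F: "F x (- b + 2 * h) = F x (b - 2 * h)" "F x (- b - 2 * h) = F x (b + 2 * h)" for x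
    using quasi_minus2[OF q, of x "b + 2 * h"] quasi_minus2[OF q, of x "b - 2 * h"] by simp_all
  have t: "theta \<tau> (- b + 2 * h) = - theta \<tau> (b - 2 * h)" "theta \<tau> (- b - 2 * h) = - theta \<tau> (b + 2 * h)"
    using theta_minus[of "b - 2 * h"] theta_minus[of "b + 2 * h"] by simp_all
  have u: "(a + - b) / 2 = (a - b) / 2" "(a - - b) / 2 = (a + b) / 2" by simp_all
  show ?thesis
    unfolding N2_def Let_def u F t theta_minus quasi_minus2[OF q] by (simp only: mult_minus_left mult_minus_right) (simp add: algebra_simps)
qed

text \<open>The swap negates \<open>v\<close>, and the factor \<open>theta \<tau> v\<close> makes
  the denominator odd; the wall at \<open>b\<close> follows from the one at
  \<open>a\<close>.\<close>

lemma N2_swap: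
  assumes q: "quasi F"
  shows "N2 h c F b a = - N2 h c F a b"
proof -
  have u: "(b + a) / 2 = (a + b) / 2" "(b - a) / 2 = - ((a - b) / 2)" by (simp_all add: field_simps)
  have t: "theta \<tau> (- w + y) = - theta \<tau> (w - y)" "theta \<tau> (- w - y) = - theta \<tau> (w + y)" for w y
    using theta_minus[of "w - y"] theta_minus[of "w + y"] by simp_all
  show ?thesis
    unfolding N2_def Let_def u quasi_swap[OF q, where a = a and b = b]
      quasi_swap[OF q, where a = "a + 2 * h" and b = "b + 2 * h"] quasi_swap[OF q, where a = "a - 2 * h" and b = "b - 2 * h"]
      quasi_swap[OF q, where a = "a - 2 * h" and b = "b + 2 * h"] quasi_swap[OF q, where a = "a + 2 * h" and b = "b - 2 * h"]
      t theta_minus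
    by (simp only: mult_minus_left mult_minus_right) (simp add: algebra_simps)
qed

text \<open>Reflection in \<open>u = lat m n\<close> interchanges the two points at which
  \<open>F\<close> is evaluated, while the theta values at \<open>lat m n - h\<close> and
  \<open>lat m n + h\<close> are opposite up to multipliers.\<close>

lemma N1_pair:
  assumes q: "quasi F"
  shows "theta \<tau> (lat m n - h) * F (lat m n + v + 2 * h) (lat m n - v) + theta \<tau> (lat m n + h) * F (lat m n + v) (lat m n - v - 2 * h) = 0"
proof -
  have F: "F (lat m n + v + 2 * h) (lat m n - v) = rho n h ^ 2 * F (lat m n + v) (lat m n - v - 2 * h)"
    using quasi_reflect[OF q, of m n "v + 2 * h" "- v"] by (simp add: rho_numeral add.assoc diff_diff_eq)
  have t: "theta \<tau> (lat m n - h) = - jac m n * inverse (rho n h) * theta \<tau> h"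
    using theta_rho[of m n "- h"] by (simp add: rho_minus)
  show ?thesis unfolding F t theta_rho by (simp add: power2_eq_square)
qed

lemma N1_wall:
  assumes q: "quasi F" and z: "theta \<tau> ((a + b) / 2) = 0"
  shows "N1 h F a b = 0"
proof -
  obtain m n where u: "(a + b) / 2 = lat m n" using z theta_zero_iff by blast
  define v where "v = (a - b) / 2"
  have ab: "a = lat m n + v" "b = lat m n - v" by (simp_all add: v_def u[symmetric] field_simps)
  \<comment> \<open>The four terms group into one pair for \<open>h\<close> and one for
    \<open>- h\<close>.\<close>
  have "N1 h F a b =
      theta \<tau> (v - h) * (theta \<tau> (lat m n - h) * F (lat m n + v + 2 * h) (lat m n - v) + theta \<tau> (lat m n + h) * F (lat m n + v) (lat m n - v - 2 * h)) +
      theta \<tau> (v + h) * (theta \<tau> (lat m n - - h) * F (lat m n + v + 2 * - h) (lat m n - v) + theta \<tau> (lat m n + - h) * F (lat m n + v) (lat m n - v - 2 * - h))"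
    unfolding N1_def Let_def u v_def[symmetric] by (simp add: ab algebra_simps)
  then show ?thesis by (simp only: N1_pair[OF q]) simp
qed

lemma theta_rho_diff: "theta \<tau> (lat m n - w) = - jac m n * inverse (rho n w) * theta \<tau> w"
  using theta_rho[of m n "- w"] by (simp add: rho_minus)

text \<open>The shift terms carry the factor \<open>theta \<tau> a\<close>. On the wall
  \<open>v = lat m n - u\<close>, so multiplication terms with opposite \<open>p\<close> and equal
  \<open>q\<close> agree up to sign and multipliers, and cancel.\<close>

lemma N2_wall_a:
  assumes "theta \<tau> a = 0"
  shows "N2 h c F a b = 0"
proof -
  obtain m n where a: "a = lat m n" using assms theta_zero_iff by blast
  define u where "u = (a + b) / 2"
  have v: "(a - b) / 2 = lat m n - u" by (simp add: u_def a field_simps)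
  have s: "lat m n - w + y = lat m n - (w - y)" "lat m n - w - y = lat m n - (w + y)" for w y by simp_all
  show ?thesis
    unfolding N2_def Let_def u_def[symmetric] v s assms unfolding a theta_rho theta_rho_diff rho_simps
    by (simp add: field_simps eval_nat_numeral)
qed

text \<open>The factor \<open>theta \<tau> u\<close> leaves only the multiplication terms for
  \<open>(eps 1, eps 2)\<close> and its negative, which are opposite because theta is odd.\<close>

lemma N2_wall_u:
  assumes "theta \<tau> ((a + b) / 2) = 0"
  shows "N2 h c F a b = 0"
proof -
  obtain m n where u: "(a + b) / 2 = lat m n" using assms theta_zero_iff by blast
  define v where "v = (a - b) / 2"
  have ab: "a = lat m n + v" "b = lat m n - v" by (simp_all add: v_def u[symmetric] field_simps)
  have s: "lat m n - w + y = lat m n - (w - y)" "lat m n - w - y = lat m n - (w + y)"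
    "lat m n + w + y = lat m n + (w + y)" "lat m n + w - y = lat m n + (w - y)" for w y by simp_all
  show ?thesis
    unfolding N2_def Let_def assms v_def[symmetric] unfolding u unfolding ab s theta_rho theta_rho_diff rho_simps
    by (simp add: field_simps eval_nat_numeral)
qed

text \<open>Only the shift by \<open>2 * h\<close> in both coordinates and the multiplication term
  for \<open>(eps 1, eps 2)\<close> survive. \<open>quasi_reflect\<close> compares the two values of
  \<open>F\<close>, and theta at \<open>lat m n - 2 * h\<close> and \<open>lat m n - 6 * h\<close>
  brings in the condition on \<open>c\<close>.\<close>

lemma N2_wall_uh:
  assumes q: "quasi F" and z: "theta \<tau> ((a + b) / 2 + h) = 0" and c: "c * theta \<tau> (6 * h) = theta \<tau> (2 * h)"
  shows "N2 h c F a b = 0"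
proof -
  obtain m n where u': "(a + b) / 2 + h = lat m n" using z theta_zero_iff by blast
  define v where "v = (a - b) / 2"
  have u: "(a + b) / 2 = lat m n - h" using u' by (simp add: eq_diff_eq)
  have ab: "a = lat m n + (v - h)" "b = lat m n - (v + h)" 
    using u by (simp_all add: v_def field_simps) 
  have s: "lat m n - w + y = lat m n - (w - y)" "lat m n - w - y = lat m n - (w + y)"
    "lat m n + w + y = lat m n + (w + y)" "lat m n + w - y = lat m n + (w - y)" for w y by simp_all
  have F: "F (a + 2 * h) (b + 2 * h) = rho n h ^ 2 * F a b"
  proof -
    have "F (a + 2 * h) (b + 2 * h) = F (lat m n + (v + h)) (lat m n + (h - v))"
      unfolding ab by (simp add: algebra_simps)
    also have "\<dots> = rho n (2 * h) * F (lat m n - (h - v)) (lat m n - (v + h))"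
    proof -
      have "v + h + (h - v) = 2 * h" by simp
      then show ?thesis using quasi_reflect[OF q, of m n "v + h" "h - v"] by (simp only:)
    qed
    also have "lat m n - (h - v) = lat m n + (v - h)" by simp
    finally show ?thesis unfolding ab by (simp only: rho_numeral)
  qed
  \<comment> \<open>With \<open>u = (a + b) / 2\<close>, these are the two surviving terms stripped
    of \<open>theta \<tau> v * theta \<tau> (v + h) * theta \<tau> (v - h) * theta \<tau> (u -
    h)\<close>.\<close>
  have "theta \<tau> a * theta \<tau> b * theta \<tau> ((a + b) / 2) * theta \<tau> ((a + b) / 2 - h) * F (a + 2 * h) (b + 2 * h) +
      c * theta \<tau> (a + 2 * h) * theta \<tau> (b + 2 * h) * theta \<tau> ((a + b) / 2 - 5 * h) * theta \<tau> ((a + b) / 2 + 2 * h) * F a b = 0"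
  proof -
    have e: "v - h + 2 * h = v + h" "v + h - 2 * h = v - h" "h + h = 2 * h" "h + 5 * h = 6 * h" "h - 2 * h = - h" by simp_all
    show ?thesis
      unfolding F u unfolding ab s e theta_rho theta_rho_diff rho_simps
      using c by (simp add: field_simps eval_nat_numeral)
  qed
  then show ?thesis
    unfolding N2_def Let_def z v_def[symmetric] by simp algebra
qed

section \<open>Comparison of the numerators with the operators\<close>

lemma entire2_theta: "affine2 g \<Longrightarrow> entire2 (\<lambda>x. theta \<tau> (g x))"
  using entire2_lin[OF theta_holomorphic] by (auto simp: affine2_def)

lemma entire2_shift: "entire2 f \<Longrightarrow> affine2 g \<Longrightarrow> affine2 k \<Longrightarrow> entire2 (\<lambda>x. f (vector [g x, k x]))"
  using entire2_affine by (auto simp: affine2_def)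

lemma entire2_N1: "entire2 f \<Longrightarrow> entire2 (\<lambda>x. N1 h (\<lambda>a b. f (vector [a, b])) (x $ 1) (x $ 2))"
  unfolding N1_def Let_def
  by (intro entire2_add entire2_mult entire2_const entire2_theta entire2_shift affine2_intros)

lemma entire2_N2: "entire2 f \<Longrightarrow> entire2 (\<lambda>x. N2 h c (\<lambda>a b. f (vector [a, b])) (x $ 1) (x $ 2))"
  unfolding N2_def Let_def
  by (intro entire2_add entire2_mult entire2_const entire2_theta entire2_shift affine2_intros)

lemma psi_minus1:
  assumes q: "quasi F"
  shows "psi h F (- a) b = psi (- h) F a b"
proof -
  have F: "F (- a + 2 * h) b = F (a + 2 * - h) b"
    using quasi_minus1[OF q, of "a + 2 * - h" b] by simp
  have u: "(- a + b) / 2 = - ((a - b) / 2)" "(- a - b) / 2 = - ((a + b) / 2)" by (simp_all add: field_simps)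
  have t: "theta \<tau> (- w - h) / theta \<tau> (- w) = theta \<tau> (w - - h) / theta \<tau> w" for w
    using theta_minus[of "w + h"] by simp
  show ?thesis unfolding psi_def u F t by (simp only: mult_ac)
qed

text \<open>Trades the sign of the arguments for that of \<open>h\<close>, so that
  \<open>phi_times\<close> at \<open>h\<close> and \<open>- h\<close> covers all summands of
  \<open>R2\<close>.\<close>

lemma phi_minus:
  assumes q: "quasi F"
  shows "phi h c F (- a) (- b) = phi (- h) c F a b"
proof -
  have F: "F (- a + 2 * h) (- b + 2 * h) = F (a + 2 * - h) (b + 2 * - h)"
    using quasi_minus1[OF q, of "a + 2 * - h" "b + 2 * - h"] quasi_minus2[OF q, of "- (a + 2 * - h)" "b + 2 * - h"] by simp
  have u: "(- a + - b) / 2 = - ((a + b) / 2)" by (simp add: field_simps)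
  have t: "theta \<tau> (- w + y) / theta \<tau> (- w + z) = theta \<tau> (w - y) / theta \<tau> (w - z)"
    "theta \<tau> (- w + y) / theta \<tau> (- w) = theta \<tau> (w - y) / theta \<tau> w"
    "theta \<tau> (- w - y) / theta \<tau> (- w + z) = theta \<tau> (w + y) / theta \<tau> (w - z)" for w y z
    using theta_minus[of "w - y"] theta_minus[of "w - z"] theta_minus[of "w + y"] by simp_all
  have F': "F (- a) (- b) = F a b" by (simp add: quasi_minus1[OF q] quasi_minus2[OF q])
  show ?thesis unfolding phi_def u F t F' by simp
qed

lemma N1_eq:
  assumes q: "quasi F" and u: "theta \<tau> ((a + b) / 2) \<noteq> 0" and v: "theta \<tau> ((a - b) / 2) \<noteq> 0"
  shows "N1 h F a b = theta \<tau> ((a + b) / 2) * theta \<tau> ((a - b) / 2) * R1 h F a b"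
proof -
  have ba: "(b + a) / 2 = (a + b) / 2" "(b - a) / 2 = - ((a - b) / 2)" by (simp_all add: field_simps)
  have t: "theta \<tau> (- w - y) / theta \<tau> (- w) = theta \<tau> (w + y) / theta \<tau> w"
    "theta \<tau> (- w + y) / theta \<tau> (- w) = theta \<tau> (w - y) / theta \<tau> w" for w y
    using theta_minus[of "w + y"] theta_minus[of "w - y"] by simp_all
  have F: "F (b + y) a = F a (b + y)" "F (b - y) a = F a (b - y)" for y by (rule quasi_swap[OF q])+
  have m: "2 * - h = - (2 * h)" "w - - h = w + h" "a + - (2 * h) = a - 2 * h" "b + - (2 * h) = b - 2 * h" for w
    by simp_all
  have cancel: "theta \<tau> ((a + b) / 2) * theta \<tau> ((a - b) / 2) *
      (x / theta \<tau> ((a + b) / 2) * (y / theta \<tau> ((a - b) / 2)) * z) = x * y * z" for x y z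
    using u v by simp
  show ?thesis
    unfolding R1_def psi_minus1[OF q] unfolding psi_def ba m unfolding F t N1_def Let_def distrib_left cancel ..
qed

lemma phi_times:
  assumes "theta \<tau> a \<noteq> 0" "theta \<tau> b \<noteq> 0" "theta \<tau> ((a + b) / 2) \<noteq> 0" "theta \<tau> ((a + b) / 2 + h) \<noteq> 0"
  shows "theta \<tau> a * theta \<tau> b * theta \<tau> ((a + b) / 2) * theta \<tau> ((a + b) / 2 + h) * phi h c F a b =
    theta \<tau> a * theta \<tau> b * theta \<tau> ((a + b) / 2) * theta \<tau> ((a + b) / 2 - h) * F (a + 2 * h) (b + 2 * h) +
    c * theta \<tau> (a + 2 * h) * theta \<tau> (b + 2 * h) * theta \<tau> ((a + b) / 2 - 5 * h) * theta \<tau> ((a + b) / 2 + 2 * h) * F a b"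
proof -
  have "A * B * U * P * (M / P * F1 + c * (A' / A) * (B' / B) * (X / P) * (Y / U) * F0) =
      A * B * U * M * F1 + c * A' * B' * X * Y * F0" if "A \<noteq> 0" "B \<noteq> 0" "U \<noteq> 0" "P \<noteq> 0"
    for A B U P M F1 A' B' X Y F0 :: complex
    using that by (simp add: distrib_left)
  then show ?thesis unfolding phi_def using assms by blast
qed

lemma N2_eq:
  assumes q: "quasi F" and a: "theta \<tau> a \<noteq> 0" and b: "theta \<tau> b \<noteq> 0"
    and u: "theta \<tau> ((a + b) / 2) \<noteq> 0" "theta \<tau> ((a + b) / 2 + h) \<noteq> 0" "theta \<tau> ((a + b) / 2 - h) \<noteq> 0"
    and v: "theta \<tau> ((a - b) / 2) \<noteq> 0" "theta \<tau> ((a - b) / 2 + h) \<noteq> 0" "theta \<tau> ((a - b) / 2 - h) \<noteq> 0"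
  shows "N2 h c F a b = theta \<tau> a * theta \<tau> b * theta \<tau> ((a + b) / 2) * theta \<tau> ((a - b) / 2) *
    theta \<tau> ((a + b) / 2 + h) * theta \<tau> ((a + b) / 2 - h) * theta \<tau> ((a - b) / 2 + h) * theta \<tau> ((a - b) / 2 - h) * R2 h c F a b"
proof -
  have F: "F x (2 * h - b) = F x (b - 2 * h)" "F x (- b - 2 * h) = F x (b + 2 * h)" for x
    using quasi_minus2[OF q, of x "b + 2 * h"] quasi_minus2[OF q, of x "b - 2 * h"] by simp_all
  have t: "theta \<tau> (2 * h - b) = - theta \<tau> (b - 2 * h)" "theta \<tau> (- b - 2 * h) = - theta \<tau> (b + 2 * h)"
    using theta_minus[of "b - 2 * h"] theta_minus[of "b + 2 * h"] by simp_all
  have R: "R2 h c F a b = phi h c F a b + phi (- h) c F a b + phi h c F a (- b) + phi (- h) c F a (- b)"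
    unfolding R2_def using phi_minus[OF q, of h c a b] phi_minus[OF q, of h c a "- b"] by simp
  define U V where "U = (a + b) / 2" and "V = (a - b) / 2"
  have p1: "theta \<tau> a * theta \<tau> b * theta \<tau> U * theta \<tau> (U + h) * phi h c F a b =
    theta \<tau> a * theta \<tau> b * theta \<tau> U * theta \<tau> (U - h) * F (a + 2 * h) (b + 2 * h) +
    c * theta \<tau> (a + 2 * h) * theta \<tau> (b + 2 * h) * theta \<tau> (U - 5 * h) * theta \<tau> (U + 2 * h) * F a b"
    unfolding U_def by (rule phi_times) fact+
  have p2: "theta \<tau> a * theta \<tau> b * theta \<tau> U * theta \<tau> (U - h) * phi (- h) c F a b =
    theta \<tau> a * theta \<tau> b * theta \<tau> U * theta \<tau> (U + h) * F (a - 2 * h) (b - 2 * h) +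
    c * theta \<tau> (a - 2 * h) * theta \<tau> (b - 2 * h) * theta \<tau> (U + 5 * h) * theta \<tau> (U - 2 * h) * F a b"
    unfolding U_def using phi_times[of a b "- h" c F] a b u by simp
  \<comment> \<open>With \<open>- b\<close> in place of \<open>b\<close> both sides change sign
    through theta's oddness; the subtraction in the final combination absorbs this.\<close>
  have p3: "- (theta \<tau> a * theta \<tau> b * theta \<tau> V * theta \<tau> (V + h) * phi h c F a (- b)) =
    - (theta \<tau> a * theta \<tau> b * theta \<tau> V * theta \<tau> (V - h) * F (a + 2 * h) (b - 2 * h)) -
    c * theta \<tau> (a + 2 * h) * theta \<tau> (b - 2 * h) * theta \<tau> (V - 5 * h) * theta \<tau> (V + 2 * h) * F a b"
    unfolding V_def using phi_times[of a "- b" h c F] a b v by (simp add: F t quasi_minus2[OF q])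
  have p4: "- (theta \<tau> a * theta \<tau> b * theta \<tau> V * theta \<tau> (V - h) * phi (- h) c F a (- b)) =
    - (theta \<tau> a * theta \<tau> b * theta \<tau> V * theta \<tau> (V + h) * F (a - 2 * h) (b + 2 * h)) -
    c * theta \<tau> (a - 2 * h) * theta \<tau> (b + 2 * h) * theta \<tau> (V + 5 * h) * theta \<tau> (V - 2 * h) * F a b"
    unfolding V_def using phi_times[of a "- b" "- h" c F] a b v by (simp add: F t quasi_minus2[OF q])
  have "theta \<tau> a * theta \<tau> b * theta \<tau> U * theta \<tau> V * theta \<tau> (U + h) * theta \<tau> (U - h) * theta \<tau> (V + h) * theta \<tau> (V - h) * R2 h c F a b =
     theta \<tau> V * theta \<tau> (V + h) * theta \<tau> (V - h) *
       (theta \<tau> (U - h) * (theta \<tau> a * theta \<tau> b * theta \<tau> U * theta \<tau> (U + h) * phi h c F a b) +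
        theta \<tau> (U + h) * (theta \<tau> a * theta \<tau> b * theta \<tau> U * theta \<tau> (U - h) * phi (- h) c F a b)) -
     theta \<tau> U * theta \<tau> (U + h) * theta \<tau> (U - h) *
       (theta \<tau> (V - h) * - (theta \<tau> a * theta \<tau> b * theta \<tau> V * theta \<tau> (V + h) * phi h c F a (- b)) +
        theta \<tau> (V + h) * - (theta \<tau> a * theta \<tau> b * theta \<tau> V * theta \<tau> (V - h) * phi (- h) c F a (- b)))"
    unfolding R by (simp add: algebra_simps)
  also have "\<dots> = N2 h c F a b"
    unfolding p1 p2 p3 p4 N2_def Let_def U_def[symmetric] V_def[symmetric] by (simp add: algebra_simps)
  finally show ?thesis by (simp only: U_def V_def)
qed

section \<open>Transversality of the walls and conclusion\<close>

lemma theta_zero_diff: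
  assumes "theta \<tau> z = 0" "theta \<tau> w = 0"
  shows "theta \<tau> (w - z) = 0"
proof -
  obtain m n m' n' where "z = lat m n" "w = lat m' n'" using assms theta_zero_iff by blast
  then have "w - z = lat (m' - m) (n' - n)" by (simp add: lat_def algebra_simps)
  then show ?thesis using theta_zero_iff by blast
qed

text \<open>A common zero would make \<open>c' - c\<close> a difference of lattice points, hence a
  zero of theta.\<close>

lemma transversal_parallel:
  assumes "theta \<tau> (c' - c) \<noteq> 0"
  shows "transversal (p, q, c) (p, q, c')"
  using theta_zero_diff[of "p * x $ 1 + q * x $ 2 + c" "p * x $ 1 + q * x $ 2 + c'" for x :: weight] assms
  by (auto simp: transversal_def)

lemma transversal_skew: "p * q' \<noteq> p' * q \<Longrightarrow> transversal (p, q, c) (p', q', c')"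
  by (simp add: transversal_def)

lemma M1_preserves:
  assumes f: "f \<in> ThW \<tau>"
  shows "\<exists>g\<in>ThW \<tau>. meromorphic_equals (M1_regular \<tau>) (M1 \<tau> h f) g"
proof -
  let ?F = "\<lambda>a b. f (vector [a, b])"
  have q: "quasi ?F" using f by (rule ThW_imp_quasi)
  have e: "entire2 f" using f by (simp add: ThW_def)
  define ws :: "(complex \<times> complex \<times> complex) list" where "ws = [(1/2, 1/2, 0), (1/2, - (1/2), 0)]"
  have l: "lin (1/2, 1/2, 0) x = (x $ 1 + x $ 2) / 2" "lin (1/2, - (1/2), 0) x = (x $ 1 - x $ 2) / 2" for x
    by (simp_all add: add_divide_distrib diff_divide_distrib)
  have "\<exists>g\<in>ThW \<tau>. meromorphic_equals {x. \<forall>w\<in>set ws. theta \<tau> (lin w x) \<noteq> 0} (\<lambda>x. R1 h ?F (x $ 1) (x $ 2)) g"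
  proof (rule ThW_extension[OF entire2_N1[OF e] _ _ _ _ quasi_R1[OF q]])
    show "nondeg w" if "w \<in> set ws" for w using that by (auto simp: ws_def)
    show "N1 h ?F (x $ 1) (x $ 2) = 0" if w: "w \<in> set ws" "theta \<tau> (lin w x) = 0" for w and x :: weight
    proof -
      consider "theta \<tau> ((x $ 1 + x $ 2) / 2) = 0" | "theta \<tau> ((x $ 1 + - x $ 2) / 2) = 0"
        using w by (auto simp: ws_def l simp del: lin_simp)
      then show ?thesis
      proof cases
        case 1
        then show ?thesis by (rule N1_wall[OF q])
      next
        case 2
        then show ?thesis using N1_wall[OF q, of "x $ 1" "- x $ 2"] N1_minus2[OF q, of h "x $ 1" "x $ 2"] by simp
      qed
    qed
    show "sorted_wrt transversal ws" by (simp add: ws_def transversal_skew)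
    fix a b assume "\<forall>w\<in>set ws. theta \<tau> (lin w (vector [a, b])) \<noteq> 0"
    then show "N1 h ?F ((vector [a, b] :: weight) $ 1) ((vector [a, b] :: weight) $ 2) =
        (\<Prod>w\<leftarrow>ws. theta \<tau> (lin w (vector [a, b]))) * R1 h ?F a b"
      using N1_eq[OF q, of a b h] by (simp add: ws_def l del: lin_simp)
  qed
  moreover have "{x. \<forall>w\<in>set ws. theta \<tau> (lin w x) \<noteq> 0} = M1_regular \<tau>"
  proof -
    have P: "(\<forall>p\<in>P1. Q p) \<longleftrightarrow> Q (eps 1) \<and> Q (- eps 1) \<and> Q (eps 2) \<and> Q (- eps 2)" for Q by (auto simp: P1_def)
    have fm: "form x (eps 1 + eps 2) = (x $ 1 + x $ 2) / 2" "form x (eps 1 + - eps 2) = (x $ 1 - x $ 2) / 2"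
      "form x (- eps 1 + eps 2) = - ((x $ 1 - x $ 2) / 2)" "form x (- eps 1 + - eps 2) = - ((x $ 1 + x $ 2) / 2)"
      "form x (eps 2 + eps 1) = (x $ 1 + x $ 2) / 2" "form x (eps 2 + - eps 1) = - ((x $ 1 - x $ 2) / 2)"
      "form x (- eps 2 + eps 1) = (x $ 1 - x $ 2) / 2" "form x (- eps 2 + - eps 1) = - ((x $ 1 + x $ 2) / 2)" for x
      by (simp_all add: form_2 eps_nth field_simps)
    show ?thesis
      unfolding M1_regular_def P P1_minus ball_simps fm theta_minus ws_def by (auto simp: l fm simp del: lin_simp)
  qed
  moreover have "(\<lambda>x. R1 h ?F (x $ 1) (x $ 2)) = M1 \<tau> h f" by (simp add: fun_eq_iff M1_eq_R1[OF q])
  ultimately show ?thesis by simp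
qed

lemma M2_preserves:
  assumes f: "f \<in> ThW \<tau>" and h: "theta \<tau> h \<noteq> 0" "theta \<tau> (2 * h) \<noteq> 0" "theta \<tau> (6 * h) \<noteq> 0"
  shows "\<exists>g\<in>ThW \<tau>. meromorphic_equals (M2_regular \<tau> h) (M2 \<tau> h f) g"
proof -
  let ?F = "\<lambda>a b. f (vector [a, b])"
  define c where "c = theta \<tau> (2 * h) / theta \<tau> (6 * h)"
  have q: "quasi ?F" using f by (rule ThW_imp_quasi)
  have e: "entire2 f" using f by (simp add: ThW_def)
  have c: "c * theta \<tau> (6 * h) = theta \<tau> (2 * h)" using h by (simp add: c_def)
  define ws :: "(complex \<times> complex \<times> complex) list" where
    "ws = [(1, 0, 0), (0, 1, 0), (1/2, 1/2, 0), (1/2, - (1/2), 0), (1/2, 1/2, h), (1/2, 1/2, - h), (1/2, - (1/2), h), (1/2, - (1/2), - h)]"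
  have l: "lin (1/2, 1/2, y) x = (x $ 1 + x $ 2) / 2 + y" "lin (1/2, - (1/2), y) x = (x $ 1 - x $ 2) / 2 + y"
    "lin (1, 0, 0) x = x $ 1" "lin (0, 1, 0) x = x $ 2" for x y
    by (simp_all add: add_divide_distrib diff_divide_distrib)
  have wu: "N2 h c ?F a b = 0" if "theta \<tau> ((a + b) / 2) = 0 \<or> theta \<tau> ((a + b) / 2 + h) = 0 \<or> theta \<tau> ((a + b) / 2 - h) = 0" for a b
  proof -
    \<comment> \<open>The constant is even in \<open>h\<close>, so the wall \<open>u - h\<close> is
      the wall \<open>u + h\<close> for \<open>- h\<close>.\<close>
    have "c * theta \<tau> (6 * - h) = theta \<tau> (2 * - h)" using c by simp
    then show ?thesis
      using that N2_wall_u[of a b h c ?F] N2_wall_uh[OF q _ c, of a b] N2_wall_uh[OF q, of a b "- h" c]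
      by (auto simp: N2_minus_h)
  qed
  have "\<exists>g\<in>ThW \<tau>. meromorphic_equals {x. \<forall>w\<in>set ws. theta \<tau> (lin w x) \<noteq> 0} (\<lambda>x. R2 h c ?F (x $ 1) (x $ 2)) g"
  proof (rule ThW_extension[OF entire2_N2[OF e] _ _ _ _ quasi_R2[OF q]])
    show "nondeg w" if "w \<in> set ws" for w using that by (auto simp: ws_def)
    show "N2 h c ?F (x $ 1) (x $ 2) = 0" if w: "w \<in> set ws" "theta \<tau> (lin w x) = 0" for w and x :: weight
    proof -
      let ?a = "x $ 1" and ?b = "x $ 2"
      consider "theta \<tau> ?a = 0" | "theta \<tau> ?b = 0"
        | "theta \<tau> ((?a + ?b) / 2) = 0 \<or> theta \<tau> ((?a + ?b) / 2 + h) = 0 \<or> theta \<tau> ((?a + ?b) / 2 - h) = 0"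
        | "theta \<tau> ((?a + - ?b) / 2) = 0 \<or> theta \<tau> ((?a + - ?b) / 2 + h) = 0 \<or> theta \<tau> ((?a + - ?b) / 2 - h) = 0"
        using w by (auto simp: ws_def l simp del: lin_simp)
      then show ?thesis
      proof cases
        case 1
        then show ?thesis by (rule N2_wall_a)
      next
        case 2
        then show ?thesis using N2_wall_a[of ?b h c ?F ?a] N2_swap[OF q, of h c ?b ?a] by simp
      next
        case 3
        then show ?thesis by (rule wu)
      next
        case 4
        then show ?thesis using wu[of ?a "- ?b"] N2_minus2[OF q, of h c ?a ?b] by simp
      qed
    qed
    \<comment> \<open>The constants of the parallel walls \<open>u\<close>, \<open>u + h\<close>,
      \<open>u - h\<close>, and likewise for \<open>v\<close>, differ by \<open>h\<close>,
      \<open>- h\<close> and \<open>- 2 * h\<close>.\<close>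
    have "theta \<tau> (- h) \<noteq> 0" "theta \<tau> (- h - h) \<noteq> 0" using h theta_minus[of "2 * h"] by auto
    then show "sorted_wrt transversal ws"
      using h by (simp add: ws_def transversal_skew transversal_parallel)
    fix a b assume "\<forall>w\<in>set ws. theta \<tau> (lin w (vector [a, b])) \<noteq> 0"
    then show "N2 h c ?F ((vector [a, b] :: weight) $ 1) ((vector [a, b] :: weight) $ 2) =
        (\<Prod>w\<leftarrow>ws. theta \<tau> (lin w (vector [a, b]))) * R2 h c ?F a b"
      using N2_eq[OF q, of a b h c] by (simp add: ws_def l mult.assoc del: lin_simp)
  qed
  moreover have "{x. \<forall>w\<in>set ws. theta \<tau> (lin w x) \<noteq> 0} = M2_regular \<tau> h"
  proof -
    have fm: "form x (eps 1 + eps 2) = (x $ 1 + x $ 2) / 2" "form x (eps 1 + - eps 2) = (x $ 1 - x $ 2) / 2"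
      "form x (- eps 1 + eps 2) = - ((x $ 1 - x $ 2) / 2)" "form x (- eps 1 + - eps 2) = - ((x $ 1 + x $ 2) / 2)"
      "2 * form x (eps 1) = x $ 1" "2 * form x (- eps 1) = - x $ 1" "2 * form x (eps 2) = x $ 2" "2 * form x (- eps 2) = - x $ 2" for x
      by (simp_all add: form_2 eps_nth field_simps)
    have t: "theta \<tau> (- w + h) = - theta \<tau> (w - h)" for w
      using theta_minus[of "w - h"] by simp
    have P: "(\<forall>p\<in>{eps 1, - eps 1}. \<forall>q\<in>{eps 2, - eps 2}. Q p q) \<longleftrightarrow>
        Q (eps 1) (eps 2) \<and> Q (eps 1) (- eps 2) \<and> Q (- eps 1) (eps 2) \<and> Q (- eps 1) (- eps 2)" for Q by auto
    show ?thesis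
      unfolding M2_regular_def P fm t theta_minus ws_def by (auto simp: l simp del: lin_simp)
  qed
  moreover have "(\<lambda>x. R2 h c ?F (x $ 1) (x $ 2)) = M2 \<tau> h f" by (simp add: fun_eq_iff M2_eq_R2[OF q] c_def)
  ultimately show ?thesis by simp
qed

end

theorem theorem2:
  fixes \<tau> h :: complex
  assumes "Im \<tau> > 0"
    and "h \<noteq> 0"
    and "\<And>m :: int. m \<noteq> 0 \<Longrightarrow> theta \<tau> (of_int m * h) \<noteq> 0"
  shows "\<forall>f\<in>ThW \<tau>.
      (\<exists>g\<in>ThW \<tau>. meromorphic_equals (M1_regular \<tau>) (M1 \<tau> h f) g) \<and>
      (\<exists>g\<in>ThW \<tau>. meromorphic_equals (M2_regular \<tau> h) (M2 \<tau> h f) g)"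
proof -
  interpret upper_half \<tau> by unfold_locales fact
  show ?thesis
    \<comment> \<open>Genericity enters through [h] and [2h], which keep parallel walls disjoint,
      and [6h], the denominator of the constant.\<close>
    using M1_preserves M2_preserves assms(3)[of 1] assms(3)[of 2] assms(3)[of 6] by simp
qed

end
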